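(* On a word RAM with words of $\Omega(\lg n)$ bits, a set $S \subseteq \{1,\dots,n\}$ can be maintained using $n+o(n)$ bits so that each of the operations insert$(i)$, delete$(i)$, search$(i)$ and findany takes constant (worst-case) time. Moreover, all elements of the set can be enumerated (in no particular order) in $O(k+1)$ time, where $k$ is the current number of elements of the set, and the data structure can be initialized in $O(1)$ time.
   Context: Operations: insert$(i)$ adds $i$ to $S$; search$(i)$ determines whether $i\in S$; delete$(i)$ removes $i$ from $S$ if present; findany returns the value of some (arbitrary) element of $S$, or a NIL value if $S$ is empty. Space is measured in bits of working memory; logical, arithmetic and bitwise operations on a constant number of words take constant time. *)

theory Defs
  imports Complex_Main "HOL-Library.Landau_Symbols"
begin

unbundle bit_operations_syntax

text \<open>
  A word RAM with word length \<open>w\<close>, presented as a small imperative language.  Memory consists of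
  individually counted bits, accessed in words of \<open>w\<close> consecutive bits.  A register holds \<open>K\<close> words,
  where \<open>K\<close> is a constant of the program: this renders the convention that operations on a
  constant number of words take constant time, and it makes arguments and addresses that need more
  than \<open>w\<close> (but still \<open>O(w)\<close>) bits available.  Register arithmetic is modulo \<open>2 ^ (K * w)\<close>.
\<close>

datatype binop = Add | Sub | Mul | Quot | Rem | Conj | Disj | Xor | Shl | Shr | Less | Equal

datatype expr = Const nat | Reg nat | Load expr | Op binop expr expr

datatype com =
    Skip
  | Assign nat expr
  | Store expr expr
  | Emit expr
  | Seq com com
  | If expr com com
  | While expr com

record state =
  regs :: "nat \<Rightarrow> nat"
  mem :: "bool list"
  out :: "nat list"

fun binop_val :: "nat \<Rightarrow> binop \<Rightarrow> nat \<Rightarrow> nat \<Rightarrow> nat" where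
  "binop_val N Add x y = x + y"
| "binop_val N Sub x y = 2 ^ N + x - y"
| "binop_val N Mul x y = x * y"
| "binop_val N Quot x y = x div y"
| "binop_val N Rem x y = x mod y"
| "binop_val N Conj x y = x AND y"
| "binop_val N Disj x y = x OR y"
| "binop_val N Xor x y = x XOR y"
| "binop_val N Shl x y = push_bit y x"
| "binop_val N Shr x y = drop_bit y x"
| "binop_val N Less x y = of_bool (x < y)"
| "binop_val N Equal x y = of_bool (x = y)"

text \<open>
  Word \<open>a\<close> comprises the bits \<open>a * w, \<dots>, a * w + w - 1\<close>, least significant first.  There are exactly
  \<open>length m\<close> bits of storage: positions beyond the end (in particular the missing part of an
  incomplete last word) read as 0, and writing to them has no effect.
\<close>

definition read_word :: "nat \<Rightarrow> bool list \<Rightarrow> nat \<Rightarrow> nat" where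
  "read_word w m a = horner_sum of_bool 2 (take w (drop (a * w) m))"

definition write_word :: "nat \<Rightarrow> bool list \<Rightarrow> nat \<Rightarrow> nat \<Rightarrow> bool list" where
  "write_word w m a v =
     map (\<lambda>p. if p div w = a then bit v (p mod w) else m ! p) [0..<length m]"

fun eval_expr :: "nat \<Rightarrow> nat \<Rightarrow> state \<Rightarrow> expr \<Rightarrow> nat" where
  "eval_expr w K s (Const k) = take_bit (K * w) k"
| "eval_expr w K s (Reg x) = regs s x"
| "eval_expr w K s (Load e) = take_bit (K * w) (read_word w (mem s) (eval_expr w K s e))"
| "eval_expr w K s (Op f e1 e2) =
     take_bit (K * w) (binop_val (K * w) f (eval_expr w K s e1) (eval_expr w K s e2))"

fun cost :: "expr \<Rightarrow> nat" where
  "cost (Const k) = 1"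
| "cost (Reg x) = 1"
| "cost (Load e) = 1 + cost e"
| "cost (Op f e1 e2) = 1 + cost e1 + cost e2"

text \<open>\<open>exec w K c s t s'\<close>: program \<open>c\<close>, started in \<open>s\<close>, halts in \<open>s'\<close> after exactly \<open>t\<close> time units.\<close>

inductive exec :: "nat \<Rightarrow> nat \<Rightarrow> com \<Rightarrow> state \<Rightarrow> nat \<Rightarrow> state \<Rightarrow> bool" for w K :: nat where
  Skip: "exec w K Skip s 1 s"
| Assign: "exec w K (Assign x e) s (1 + cost e) (s\<lparr>regs := (regs s)(x := eval_expr w K s e)\<rparr>)"
| Store: "exec w K (Store a e) s (1 + cost a + cost e)
    (s\<lparr>mem := write_word w (mem s) (eval_expr w K s a) (eval_expr w K s e)\<rparr>)"
| Emit: "exec w K (Emit e) s (1 + cost e) (s\<lparr>out := out s @ [eval_expr w K s e]\<rparr>)"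
| Seq: "exec w K c1 s t1 s1 \<Longrightarrow> exec w K c2 s1 t2 s2 \<Longrightarrow> exec w K (Seq c1 c2) s (t1 + t2) s2"
| IfTrue: "eval_expr w K s e \<noteq> 0 \<Longrightarrow> exec w K c1 s t s1 \<Longrightarrow>
    exec w K (If e c1 c2) s (1 + cost e + t) s1"
| IfFalse: "eval_expr w K s e = 0 \<Longrightarrow> exec w K c2 s t s1 \<Longrightarrow>
    exec w K (If e c1 c2) s (1 + cost e + t) s1"
| WhileTrue: "eval_expr w K s e \<noteq> 0 \<Longrightarrow> exec w K c s t1 s1 \<Longrightarrow>
    exec w K (While e c) s1 t2 s2 \<Longrightarrow> exec w K (While e c) s (1 + cost e + t1 + t2) s2"
| WhileFalse: "eval_expr w K s e = 0 \<Longrightarrow> exec w K (While e c) s (1 + cost e) s"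

inductive_cases exec_SkipE: "exec w K Skip s t s'"
inductive_cases exec_AssignE: "exec w K (Assign x e) s t s'"
inductive_cases exec_StoreE: "exec w K (Store a e) s t s'"
inductive_cases exec_EmitE: "exec w K (Emit e) s t s'"
inductive_cases exec_SeqE: "exec w K (Seq c1 c2) s t s'"
inductive_cases exec_IfE: "exec w K (If e c1 c2) s t s'"
inductive_cases exec_WhileE: "exec w K (While e c) s t s'"

lemma exec_deterministic:
  assumes "exec w K c s t s'" and "exec w K c s u s''"
  shows "t = u \<and> s' = s''"
  using assms
proof (induction arbitrary: u s'' rule: exec.induct)
  case (Skip s)
  then show ?case by (elim exec_SkipE) simp
next
  case (Assign x e s)
  then show ?case by (elim exec_AssignE) simp
next
  case (Store a e s)
  then show ?case by (elim exec_StoreE) simp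
next
  case (Emit e s)
  then show ?case by (elim exec_EmitE) simp
next
  case (Seq c1 s t1 s1 c2 t2 s2)
  from Seq.prems obtain u1 u2 r where "u = u1 + u2" "exec w K c1 s u1 r" "exec w K c2 r u2 s''"
    by (elim exec_SeqE)
  with Seq.IH(1)[of u1 r] Seq.IH(2)[of u2 s''] show ?case by simp
next
  case (IfTrue s e c1 t s1 c2)
  from IfTrue.prems IfTrue.hyps(1) obtain v where "u = 1 + cost e + v" "exec w K c1 s v s''"
    by (elim exec_IfE) simp_all
  with IfTrue.IH[of v s''] show ?case by simp
next
  case (IfFalse s e c2 t s1 c1)
  from IfFalse.prems IfFalse.hyps(1) obtain v where "u = 1 + cost e + v" "exec w K c2 s v s''"
    by (elim exec_IfE) simp_all
  with IfFalse.IH[of v s''] show ?case by simp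
next
  case (WhileTrue s e c t1 s1 t2 s2)
  from WhileTrue.prems WhileTrue.hyps(1) obtain u1 u2 r
    where "u = 1 + cost e + u1 + u2" "exec w K c s u1 r" "exec w K (While e c) r u2 s''"
    by (cases rule: exec_WhileE) auto
  with WhileTrue.IH(1)[of u1 r] WhileTrue.IH(2)[of u2 s''] show ?case by simp
next
  case (WhileFalse s e c)
  from WhileFalse.prems show ?case using WhileFalse.hyps by (cases rule: exec_WhileE) auto
qed

definition halts_within ::
  "nat \<Rightarrow> nat \<Rightarrow> com \<Rightarrow> state \<Rightarrow> nat \<Rightarrow> (state \<Rightarrow> bool) \<Rightarrow> bool" where
  "halts_within w K c s T Q \<longleftrightarrow> (\<exists>t s'. exec w K c s t s' \<and> t \<le> T \<and> Q s')"

text \<open>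
  Calling convention: the argument \<open>i\<close> (0 if there is none) is in register 0, the parameters \<open>n\<close>,
  \<open>\<lfloor>lg n\<rfloor>\<close> and \<open>w\<close> are in registers 1, 2 and 3, and the result is returned in register 0.  All other
  registers are 0, so nothing except \<open>m\<close> is carried over from one call to the next.
\<close>

definition call_state :: "nat \<Rightarrow> nat \<Rightarrow> nat \<Rightarrow> nat \<Rightarrow> bool list \<Rightarrow> state" where
  "call_state w K n i m =
     \<lparr>regs = (\<lambda>r. take_bit (K * w)
               (((\<lambda>_. 0)(0 := i, 1 := n, 2 := nat \<lfloor>log 2 (real n)\<rfloor>, 3 := w)) r)),
      mem = m, out = []\<rparr>"

record set_programs =
  init_prog :: com
  insert_prog :: com
  delete_prog :: com
  search_prog :: com
  findany_prog :: com
  enum_prog :: com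

text \<open>
  \<open>rep m S\<close> reads: memory contents \<open>m\<close> represent the set \<open>S\<close>.  Initialization must cope with arbitrary
  previous contents of the memory.  As the elements are at least 1, the value 0 serves as NIL.
\<close>

definition maintains_set ::
  "nat \<Rightarrow> nat \<Rightarrow> set_programs \<Rightarrow> nat \<Rightarrow> nat \<Rightarrow> nat \<Rightarrow> bool" where
  "maintains_set w K D n bits T \<longleftrightarrow>
    (\<exists>rep :: bool list \<Rightarrow> nat set \<Rightarrow> bool.
      (\<forall>m. length m = bits \<longrightarrow>
        halts_within w K (init_prog D) (call_state w K n 0 m) T (\<lambda>s. rep (mem s) {})) \<and>
      (\<forall>m S. length m = bits \<and> S \<subseteq> {1..n} \<and> rep m S \<longrightarrow>
        (\<forall>i\<in>{1..n}.
          halts_within w K (insert_prog D) (call_state w K n i m) T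
            (\<lambda>s. rep (mem s) (S \<union> {i})) \<and>
          halts_within w K (delete_prog D) (call_state w K n i m) T
            (\<lambda>s. rep (mem s) (S - {i})) \<and>
          halts_within w K (search_prog D) (call_state w K n i m) T
            (\<lambda>s. rep (mem s) S \<and> regs s 0 = of_bool (i \<in> S))) \<and>
        halts_within w K (findany_prog D) (call_state w K n 0 m) T
          (\<lambda>s. rep (mem s) S \<and> (if S = {} then regs s 0 = 0 else regs s 0 \<in> S)) \<and>
        halts_within w K (enum_prog D) (call_state w K n 0 m) (T * (card S + 1))
          (\<lambda>s. rep (mem s) S \<and> distinct (out s) \<and> set (out s) = S)))"

end

theory Submission
  imports Defs "HOL-Real_Asymp.Real_Asymp"
begin

text \<open>
  Let \<open>f = \<lfloor>lg n\<rfloor> + 1\<close>.  The bit vector is cut into leaves of \<open>f\<close> bits and blocks of \<open>f\<close> leaves.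
  The blocks meeting \<open>S\<close> form a sparse set in the sense of Briggs and Torczon: a list \<open>Lst\<close> of
  length \<open>Cnt\<close> with back pointers \<open>Pos\<close>, which needs no initialization because an entry counts only
  if the two pointers confirm each other.  A block carries an \<open>f\<close>-bit summary of its nonempty leaves,
  meaningful only if the block is in the list, and a leaf is meaningful only if its summary bit is set.
  Pointers and summaries cost \<open>O(f)\<close> bits for every \<open>f\<^sup>2\<close> elements, hence \<open>O(n / lg n)\<close> bits.

  To find a member one isolates the lowest set bit \<open>2\<^sup>k\<close> of a summary or leaf by
  \<open>x XOR (x AND (x - 1))\<close>; recovering \<open>k\<close> is the only operation that the machine lacks.  It is read
  from a table indexed by \<open>2\<^sup>k mod M\<close>, where \<open>M = 2\<^sup>a + 1\<close> with \<open>2 a > f\<close>, so that the table has only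
  \<open>O(\<surd>n)\<close> entries and the residues are still distinct.  The table too needs no initialization: a bit
  can only be set by an insertion, which knows \<open>k\<close> and writes the entry.
\<close>

section \<open>Arrays of cells on the word RAM\<close>

text \<open>The second level pays for the space: pointers of \<open>f\<close> bits for every leaf of
  \<open>f\<close> bits would cost as much as the bit vector itself, while pointers for every
  \<open>f\<close> leaves cost only a fraction of order \<open>1 / f\<close> of it. The programs may
  depend on the function \<open>w\<close> only through constants, and \<open>w\<close> may lie below
  \<open>lg n\<close> by a constant factor; hence cells have \<open>f\<close> bits regardless of
  \<open>w\<close>, and the sole parameter of the compiler is \<open>h\<close>. Since calls share
  nothing but the memory and initialization may touch only a constant number of cells,
  \<open>M\<close> and the base addresses are recomputed from \<open>n\<close> and \<open>f\<close>
  at every use; \<open>2 ^ a + 1\<close> suits this, being one shift away. Intermediate values must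
  fit a register of \<open>K\<close> words. Therefore a loop-free language with exact arithmetic is
  interposed: its weakest preconditions contain the overflow conditions, and a constant time bound
  can be read off the compiled text.\<close>

datatype arr = Leaf | Summ | Lst | Pos | Cnt | Tab

datatype mexp = Num nat | Var nat | Width | Modulus | Cell arr mexp | Bin binop mexp mexp

datatype mcom =
    Nop
  | Asg nat mexp
  | Put arr mexp mexp
  | Out mexp
  | Then mcom mcom
  | Cond mexp mcom mcom

text \<open>
  Storage is an array of cells of \<open>f\<close> bits, not aligned with the words; if \<open>f \<le> h * w\<close>, a cell lies
  within \<open>h + 1\<close> consecutive words.  In compiled programs register 4 holds \<open>f\<close>, registers 5 and 6 are
  scratch, and variable \<open>x\<close> is register \<open>x + 7\<close>.
\<close>

fun mop :: "binop \<Rightarrow> nat \<Rightarrow> nat \<Rightarrow> nat" where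
  "mop Sub x y = x - y"
| "mop f x y = binop_val 0 f x y"

text \<open>Assembles \<open>h + 1\<close> consecutive words, least significant first, into one
  number. The recursion runs over a parameter fixed at compile time, so no loop arises.\<close>

primrec load_words :: "nat \<Rightarrow> expr \<Rightarrow> expr" where
  "load_words 0 e = Load e"
| "load_words (Suc h) e = Op Disj (Load e) (Op Shl (load_words h (Op Add e (Const 1))) (Reg 3))"

primrec store_words :: "nat \<Rightarrow> com" where
  "store_words 0 = Store (Reg 5) (Reg 6)"
| "store_words (Suc h) = Seq (Store (Reg 5) (Reg 6)) (Seq (Assign 5 (Op Add (Reg 5) (Const 1)))
     (Seq (Assign 6 (Op Shr (Reg 6) (Reg 3))) (store_words h)))"

definition addr_expr :: "expr \<Rightarrow> expr" where
  "addr_expr e = Op Quot (Op Mul e (Reg 4)) (Reg 3)"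

definition offset_expr :: "expr \<Rightarrow> expr" where
  "offset_expr e = Op Rem (Op Mul e (Reg 4)) (Reg 3)"

definition cell_expr :: "nat \<Rightarrow> expr \<Rightarrow> expr" where
  "cell_expr h e =
     Op Rem (Op Shr (load_words h (addr_expr e)) (offset_expr e)) (Op Shl (Const 1) (Reg 4))"

text \<open>The other bits of the affected words must survive: XOR with the shifted difference of
  old and new contents alters only the bits of the cell, which saves a mask. The address is
  evaluated again after register 6 has changed.\<close>

definition put_cell :: "nat \<Rightarrow> expr \<Rightarrow> expr \<Rightarrow> com" where
  "put_cell h e v =
     Seq (Assign 6 (Op Xor (load_words h (addr_expr e)) (Op Shl (Op Xor (cell_expr h e) v) (offset_expr e))))
       (Seq (Assign 5 (addr_expr e)) (store_words h))"

definition modulus_expr :: expr where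
  "modulus_expr = Op Add (Op Shl (Const 1) (Op Add (Op Quot (Reg 4) (Const 2)) (Const 1))) (Const 1)"

text \<open>The ceiling of \<open>n / (f * f)\<close>, expressed through
  \<open>n - 1\<close>.\<close>

definition blocks_expr :: expr where
  "blocks_expr = Op Add (Op Quot (Op Sub (Reg 1) (Const 1)) (Op Mul (Reg 4) (Reg 4))) (Const 1)"

text \<open>The leaves together with \<open>k\<close> arrays of one cell per block occupy
  \<open>N * (f + k)\<close> cells; hence all base addresses have this shape.\<close>

definition blocks_mult_expr :: "nat \<Rightarrow> expr" where
  "blocks_mult_expr k = Op Mul blocks_expr (Op Add (Reg 4) (Const k))"

fun base_expr :: "arr \<Rightarrow> expr" where
  "base_expr Leaf = Const 0"
| "base_expr Summ = blocks_mult_expr 0"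
| "base_expr Lst = blocks_mult_expr 1"
| "base_expr Pos = blocks_mult_expr 2"
| "base_expr Cnt = blocks_mult_expr 3"
| "base_expr Tab = Op Add (blocks_mult_expr 3) (Const 1)"

primrec compile_exp :: "nat \<Rightarrow> mexp \<Rightarrow> expr" where
  "compile_exp h (Num k) = Const k"
| "compile_exp h (Var x) = Reg (x + 7)"
| "compile_exp h Width = Reg 4"
| "compile_exp h Modulus = modulus_expr"
| "compile_exp h (Cell a e) = cell_expr h (Op Add (base_expr a) (compile_exp h e))"
| "compile_exp h (Bin f e1 e2) = Op f (compile_exp h e1) (compile_exp h e2)"

primrec compile :: "nat \<Rightarrow> mcom \<Rightarrow> com" where
  "compile h Nop = Skip"
| "compile h (Asg x e) = Assign (x + 7) (compile_exp h e)"
| "compile h (Put a i e) = put_cell h (Op Add (base_expr a) (compile_exp h i)) (compile_exp h e)"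
| "compile h (Out e) = Emit (compile_exp h e)"
| "compile h (Then c d) = Seq (compile h c) (compile h d)"
| "compile h (Cond e c d) = If (compile_exp h e) (compile h c) (compile h d)"

section \<open>Running time of loop-free code\<close>

fun loopfree :: "com \<Rightarrow> bool" where
  "loopfree (Seq c d) = (loopfree c \<and> loopfree d)"
| "loopfree (If e c d) = (loopfree c \<and> loopfree d)"
| "loopfree (While e c) = False"
| "loopfree c = True"

text \<open>A bound that depends on the program text alone. The value 0 for a loop is a dummy,
  excluded by \<open>loopfree\<close> in \<open>exec_max_time\<close>.\<close>

fun max_time :: "com \<Rightarrow> nat" where
  "max_time Skip = 1"
| "max_time (Assign x e) = 1 + cost e"
| "max_time (Store a e) = 1 + cost a + cost e"
| "max_time (Emit e) = 1 + cost e"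
| "max_time (Seq c d) = max_time c + max_time d"
| "max_time (If e c d) = 1 + cost e + max (max_time c) (max_time d)"
| "max_time (While e c) = 0"

lemma exec_max_time: "exec w K c s t s' \<Longrightarrow> loopfree c \<Longrightarrow> t \<le> max_time c"
  by (induction rule: exec.induct) auto

lemma loopfree_store_words: "loopfree (store_words h)"
  by (induction h) auto

lemma loopfree_compile: "loopfree (compile h c)"
  by (induction c) (auto simp: put_cell_def loopfree_store_words)

section \<open>The memory as a single number\<close>

definition mem_val :: "bool list \<Rightarrow> nat" where
  "mem_val m = horner_sum of_bool 2 m"

lemma bit_mem_val: "bit (mem_val m) p \<longleftrightarrow> p < length m \<and> m ! p"
  by (simp add: mem_val_def bit_horner_sum_bit_iff)

text \<open>Once the memory is one number, words, cells and runs of words are all windows cut out by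
  \<open>take_bit\<close> and \<open>drop_bit\<close>, and every claim about their overlap is
  settled bit by bit.\<close>

lemma read_word_eq: "read_word w m a = take_bit w (drop_bit (a * w) (mem_val m))"
proof (rule bit_eqI)
  fix k
  show "bit (read_word w m a) k = bit (take_bit w (drop_bit (a * w) (mem_val m))) k"
    by (auto simp: read_word_def bit_horner_sum_bit_iff bit_take_bit_iff bit_drop_bit_eq bit_mem_val)
qed

lemma length_write_word [simp]: "length (write_word w m a v) = length m"
  by (simp add: write_word_def)

lemma bit_mem_val_write_word:
  "bit (mem_val (write_word w m a v)) p \<longleftrightarrow>
     p < length m \<and> (if p div w = a then bit v (p mod w) else bit (mem_val m) p)"
  by (auto simp: bit_mem_val write_word_def)

text \<open>The unit length is arbitrary because the lemma locates a bit among words as well as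
  among cells.\<close>

lemma word_index_iff:
  fixes w :: nat
  assumes "0 < w"
  shows "p div w = a \<longleftrightarrow> a * w \<le> p \<and> p < (a + 1) * w"
proof
  assume "p div w = a"
  then show "a * w \<le> p \<and> p < (a + 1) * w"
    using assms dividend_less_div_times[of w p] by (auto simp: add.commute)
next
  assume "a * w \<le> p \<and> p < (a + 1) * w"
  then show "p div w = a" by (intro div_nat_eqI) (auto simp: mult.commute)
qed

text \<open>The order of 2 modulo \<open>2\<^sup>a + 1\<close> is \<open>2 a\<close>.\<close>

lemma inj_power2_mod:
  fixes a i j :: nat
  assumes "i < 2 * a" "j < 2 * a" "2 ^ i mod (2 ^ a + 1 :: nat) = 2 ^ j mod (2 ^ a + 1)"
  shows "i = j"
proof -
  have main: False if "i < j" "j < 2 * a" "2 ^ i mod (2 ^ a + 1 :: nat) = 2 ^ j mod (2 ^ a + 1)"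
    for i j
  proof -
    let ?M = "2 ^ a + 1 :: nat"
    define d where "d = j - i"
    have d: "0 < d" "d < 2 * a" "j = i + d" using that by (auto simp: d_def)
    have "?M dvd 2 ^ j - 2 ^ i"
      using that(3) by (metis mod_eq_dvd_iff_nat nat_le_linear diff_is_0_eq dvd_0_right)
    also have "(2::nat) ^ j - 2 ^ i = 2 ^ i * (2 ^ d - 1)"
      by (simp add: d(3) power_add algebra_simps)
    finally have "?M dvd 2 ^ i * (2 ^ d - 1)" .
    moreover have "a > 0" using d by simp
    hence "coprime ?M (2 ^ i)" by simp
    ultimately have dv: "?M dvd 2 ^ d - 1"
      using coprime_dvd_mult_right_iff by blast
    show False
    proof (cases "d \<le> a")
      case True
      have "(2::nat) ^ d \<le> 2 ^ a" using True by simp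
      moreover have "(2::nat) ^ d > 1" using d one_less_power[of "2::nat" d] by simp
      moreover have "?M \<le> 2 ^ d - 1" using dv calculation(2) by (intro dvd_imp_le) auto
      ultimately show False by linarith
    next
      case False
      define c where "c = d - a"
      have c: "d = a + c" "c < a" using False d by (auto simp: c_def)
      \<comment> \<open>Modulo \<open>2 ^ a + 1\<close> the power \<open>2 ^ a\<close> is -1, so
        \<open>2 ^ d - 1\<close> is the negative of \<open>2 ^ c + 1\<close>, which is positive and
        too small to be a multiple of the modulus.\<close>
      have "(2::nat) ^ d - 1 + (2 ^ c + 1) = 2 ^ c * ?M"
        by (simp add: c power_add algebra_simps)
      hence "?M dvd 2 ^ c + 1"
        using dv by (metis dvd_add_right_iff dvd_triv_right)
      moreover have "(2::nat) ^ c < 2 ^ a" using c by simp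
      ultimately show False by (auto dest!: dvd_imp_le)
    qed
  qed
  show ?thesis
    using main[of i j] main[of j i] assms by (metis linorder_neqE_nat)
qed

text \<open>Subtracting 1 borrows through the trailing zeros up to the lowest set bit, as the
  induction on binary digits traces. The conclusion only says that some set bit disappears, which
  suits operations that may return elements in any order.\<close>

lemma clear_lowest_bit:
  fixes x :: nat
  assumes "x \<noteq> 0"
  shows "\<exists>k. bit x k \<and> (\<forall>i. bit (x AND (x - 1)) i \<longleftrightarrow> bit x i \<and> i \<noteq> k)"
  using assms
proof (induction x rule: less_induct)
  case (less x)
  show ?case
  proof (cases "even x")
    case True
    define y where "y = x div 2"
    have y: "x = 2 * y" "y < x" "y \<noteq> 0" using True less.prems by (auto simp: y_def)
    from less.IH[OF y(2,3)] obtain k where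
      k: "bit y k" "\<And>i. bit (y AND (y - 1)) i \<longleftrightarrow> bit y i \<and> i \<noteq> k" by auto
    have x1: "x - 1 = 2 * (y - 1) + 1" using y by simp
    have "bit (x AND (x - 1)) i \<longleftrightarrow> bit x i \<and> i \<noteq> Suc k" for i
    proof -
      have "bit x (Suc m) = bit y m" "bit (x - 1) (Suc m) = bit (y - 1) m" "\<not> bit x 0" for m
        unfolding x1 using y(1) by (simp_all add: bit_Suc bit_0)
      then show ?thesis
        using k(2) unfolding bit_and_iff by (cases i) auto
    qed
    moreover have "bit x (Suc k)" using k(1) y by (simp add: bit_Suc)
    ultimately show ?thesis by blast
  next
    case False
    define y where "y = x div 2"
    have y: "x = 2 * y + 1" using False by (auto simp: y_def)
    have "bit (x AND (x - 1)) i \<longleftrightarrow> bit x i \<and> i \<noteq> 0" for i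
      using y unfolding bit_and_iff by (cases i) (auto simp: bit_Suc bit_0)
    moreover have "bit x 0" using False by (simp add: bit_0)
    ultimately show ?thesis by blast
  qed
qed

section \<open>Memory layout and overflow bounds\<close>

locale layout =
  fixes n w f h K :: nat
  assumes n_pos: "1 \<le> n" and w_pos: "1 \<le> w" and f_pos: "1 \<le> f"
    and n_less: "n < 2 ^ f" and f_le: "f \<le> h * w" and K_eq: "K = 4 * h + 8"
begin

definition "N = (n - 1) div (f * f) + 1"

definition "M = (2::nat) ^ (f div 2 + 1) + 1"

fun base :: "arr \<Rightarrow> nat" where
  "base Leaf = 0"
| "base Summ = N * f"
| "base Lst = N * f + N"
| "base Pos = N * f + 2 * N"
| "base Cnt = N * f + 3 * N"
| "base Tab = N * f + 3 * N + 1"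

fun size_of :: "arr \<Rightarrow> nat" where
  "size_of Leaf = N * f"
| "size_of Cnt = 1"
| "size_of Tab = M"
| "size_of a = N"

definition "cells = N * f + 3 * N + 1 + M"

definition "cell m c = take_bit f (drop_bit (c * f) (mem_val m))"

text \<open>The default 0 beyond the end makes each array a total function, so that storing into a
  cell is exactly a function update.\<close>

definition contents :: "bool list \<Rightarrow> arr \<Rightarrow> nat \<Rightarrow> nat" where
  "contents m a i = (if i < size_of a then cell m (base a + i) else 0)"

text \<open>Registers 0, 2, 5 and 6 are left free: the first two matter only on entry and exit, the
  others are scratch.\<close>

definition sim where
  "sim s \<rho> \<gamma> os \<longleftrightarrow> length (mem s) = cells * f \<and> regs s 1 = n \<and> regs s 3 = w \<and> regs s 4 = f \<and>
     (\<forall>v. regs s (v + 7) = \<rho> v) \<and> contents (mem s) = \<gamma> \<and> out s = os"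

primrec mval :: "(nat \<Rightarrow> nat) \<Rightarrow> (arr \<Rightarrow> nat \<Rightarrow> nat) \<Rightarrow> mexp \<Rightarrow> nat" where
  "mval \<rho> \<gamma> (Num k) = k"
| "mval \<rho> \<gamma> (Var x) = \<rho> x"
| "mval \<rho> \<gamma> Width = f"
| "mval \<rho> \<gamma> Modulus = M"
| "mval \<rho> \<gamma> (Cell a e) = \<gamma> a (mval \<rho> \<gamma> e)"
| "mval \<rho> \<gamma> (Bin g e1 e2) = mop g (mval \<rho> \<gamma> e1) (mval \<rho> \<gamma> e2)"

text \<open>No overflow, no truncated subtraction and no access outside an array, so that \<open>mval\<close> is exact.\<close>

primrec mok :: "(nat \<Rightarrow> nat) \<Rightarrow> (arr \<Rightarrow> nat \<Rightarrow> nat) \<Rightarrow> mexp \<Rightarrow> bool" where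
  "mok \<rho> \<gamma> (Num k) = (k < 2 ^ (K * w))"
| "mok \<rho> \<gamma> (Var x) = True"
| "mok \<rho> \<gamma> Width = True"
| "mok \<rho> \<gamma> Modulus = True"
| "mok \<rho> \<gamma> (Cell a e) = (mok \<rho> \<gamma> e \<and> mval \<rho> \<gamma> e < size_of a)"
| "mok \<rho> \<gamma> (Bin g e1 e2) = (mok \<rho> \<gamma> e1 \<and> mok \<rho> \<gamma> e2 \<and>
     mop g (mval \<rho> \<gamma> e1) (mval \<rho> \<gamma> e2) < 2 ^ (K * w) \<and>
     (g = Sub \<longrightarrow> mval \<rho> \<gamma> e2 \<le> mval \<rho> \<gamma> e1))"

text \<open>The purpose of the constant \<open>K = 4 * h + 8\<close>: as
  \<open>f \<le> h * w\<close>, a register has room for a product of four numbers below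
  \<open>2 ^ f\<close>, with 8 bits to spare.\<close>

lemma W_ge: "4 * f + 8 \<le> K * w"
proof -
  have "8 \<le> 8 * w" using w_pos by simp
  then show ?thesis using f_le by (simp add: K_eq algebra_simps)
qed

lemma f_less: "f < 2 ^ f" by (rule less_exp)

lemma N_le: "N \<le> n"
  using n_pos div_le_dividend[of "n - 1" "f * f"] unfolding N_def by linarith

lemma N_less: "N < 2 ^ f" using N_le n_less by simp

lemma N_pos: "1 \<le> N" by (simp add: N_def)

lemma cover: "j < n \<Longrightarrow> j div f < N * f" "j < n \<Longrightarrow> j div f div f < N"
proof -
  assume "j < n"
  then have "j div (f * f) \<le> (n - 1) div (f * f)" by (intro div_le_mono) simp
  then show *: "j div f div f < N" by (simp add: N_def div_mult2_eq)
  then show "j div f < N * f" using f_pos by (simp add: div_less_iff_less_mult)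
qed

lemma M_le: "M \<le> 2 ^ (f + 1)"
proof -
  have "(2::nat) ^ (f div 2 + 1) \<le> 2 ^ f"
    using f_pos by (intro power_increasing) auto
  moreover have "(1::nat) \<le> 2 ^ f" by simp
  ultimately show ?thesis unfolding M_def power_add[of _ f] power_one_right by linarith
qed

lemma h_less: "2 * h < 2 ^ (K * w)"
proof -
  have "h + 1 \<le> K" by (simp add: K_eq)
  then have "h + 1 \<le> K * w" using mult_le_mono2[OF w_pos, of K] by linarith
  then have "(2::nat) ^ (h + 1) \<le> 2 ^ (K * w)" by (intro power_increasing) auto
  then show ?thesis using less_exp[of h] unfolding power_add power_one_right by linarith
qed

text \<open>\<open>N\<close>, \<open>f\<close> and \<open>M / 2\<close> are at most
  \<open>2 ^ f\<close>, so the memory has fewer than \<open>2 ^ (3 * f + 3)\<close> bits. This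
  single inequality settles overflow for all addresses; the summand \<open>h\<close> covers the
  further words that a cell may reach into. The proof spends one half of the register range on
  \<open>cells * f + 2\<close> and the other on \<open>h\<close>.\<close>

lemma cells_bound: "cells * f + h + 2 < 2 ^ (K * w)"
proof -
  let ?F = "2 ^ f :: nat"
  have F: "2 \<le> ?F" using f_pos power_increasing[of 1 f "2::nat"] by simp
  have "N * f \<le> ?F * ?F" using N_less f_less by (intro mult_mono) auto
  moreover have "M \<le> 2 * ?F" using M_le by simp
  ultimately have "cells \<le> ?F * ?F + 5 * ?F + 1" using N_less unfolding cells_def by linarith
  also have "\<dots> \<le> 4 * (?F * ?F)"
    using mult_right_mono[OF F, of ?F] F by linarith
  finally have "cells * f \<le> 4 * (?F * ?F) * ?F" using f_less by (intro mult_mono) auto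
  also have "\<dots> < 8 * (?F * ?F * ?F) - 2"
  proof -
    have "8 \<le> ?F * ?F * ?F" using mult_mono[OF mult_mono[OF F F] F] by simp
    then show ?thesis by simp
  qed
  finally have "2 * (cells * f + 2) < 16 * (?F * ?F * ?F)" by simp
  also have "\<dots> = 2 ^ (f + f + f + 4)" by (simp only: power_add) simp
  also have "\<dots> \<le> 2 ^ (K * w)" using W_ge by (intro power_increasing) auto
  finally show ?thesis using h_less by simp
qed

lemma take_bit_W [simp]: "x < 2 ^ (K * w) \<Longrightarrow> take_bit (K * w) x = (x::nat)"
  by (rule take_bit_nat_eq_self)

lemma K_w_pos [simp]: "0 < K" "0 < w"
  using w_pos by (simp_all add: K_eq)

lemma W_gt1: "(1::nat) < 2 ^ (K * w)" using cells_bound by simp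

lemma superword: "(h + 1) * w \<le> K * w"
  unfolding K_eq by (intro mult_right_mono) auto

lemma f_less_W: "f < 2 ^ (K * w)"
proof -
  have "f \<le> cells * f" by (simp add: cells_def)
  then show ?thesis using cells_bound by linarith
qed

section \<open>Reading and writing a cell\<close>

lemma eval_load_words:
  assumes "regs s 3 = w" "(j + 1) * w \<le> K * w" "eval_expr w K s e = a" "a + j < 2 ^ (K * w)"
  shows "eval_expr w K s (load_words j e) = take_bit ((j + 1) * w) (drop_bit (a * w) (mem_val (mem s)))"
  using assms(2-)
proof (induction j arbitrary: e a)
  case 0
  then show ?case by (simp add: read_word_eq)
next
  case (Suc j)
  have "eval_expr w K s (Op Add e (Const 1)) = a + 1"
    using Suc.prems W_gt1 by simp
  then have IH: "eval_expr w K s (load_words j (Op Add e (Const 1))) =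
      take_bit ((j + 1) * w) (drop_bit ((a + 1) * w) (mem_val (mem s)))"
    using Suc.prems by (intro Suc.IH) auto
  show ?case
  proof (rule bit_eqI)
    fix k
    \<comment> \<open>Shifting the upper words by \<open>w\<close> loses no bit, since the whole run
      of words fits a register.\<close>
    have w: "w + (j + 1) * w \<le> K * w" using Suc.prems(1) by simp
    have "a * w + w + (k - w) = a * w + k" if "w \<le> k" using that by simp
    then show "bit (eval_expr w K s (load_words (Suc j) e)) k =
        bit (take_bit ((Suc j + 1) * w) (drop_bit (a * w) (mem_val (mem s)))) k"
      using Suc.prems IH assms(1) w
      by (auto simp: read_word_eq bit_take_bit_iff bit_or_iff bit_push_bit_iff bit_drop_bit_eq
          algebra_simps)
  qed
qed

text \<open>The offset is below \<open>w\<close> and \<open>f \<le> h * w\<close>, so a cell ends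
  within \<open>h + 1\<close> words counted from the one in which it starts.\<close>

lemma cell_pos:
  assumes "c < cells"
  shows "c * f < 2 ^ (K * w)" "c * f div w + h < 2 ^ (K * w)" "c * f mod w + f \<le> (h + 1) * w"
proof -
  have 1: "c * f \<le> cells * f" using assms by simp
  then show "c * f < 2 ^ (K * w)" using cells_bound by linarith
  have "c * f div w \<le> c * f" by simp
  then show "c * f div w + h < 2 ^ (K * w)" using 1 cells_bound by linarith
  have "c * f mod w < w" by simp
  then show "c * f mod w + f \<le> (h + 1) * w" using f_le unfolding add_mult_distrib by linarith
qed

lemma eval_pos:
  assumes "regs s 3 = w" "regs s 4 = f" "eval_expr w K s e = c" "c < cells"
  shows "eval_expr w K s (addr_expr e) = c * f div w"
    and "eval_expr w K s (offset_expr e) = c * f mod w"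
    and "eval_expr w K s (load_words h (addr_expr e)) =
      take_bit ((h + 1) * w) (drop_bit (c * f div w * w) (mem_val (mem s)))"
proof -
  have "c * f div w \<le> c * f" "c * f mod w \<le> c * f" by simp_all
  then have "c * f div w < 2 ^ (K * w)" "c * f mod w < 2 ^ (K * w)"
    using cell_pos(1)[OF assms(4)] by linarith+
  then show 1: "eval_expr w K s (addr_expr e) = c * f div w"
    and "eval_expr w K s (offset_expr e) = c * f mod w"
    using assms cell_pos[OF assms(4)] by (simp_all add: addr_expr_def offset_expr_def)
  show "eval_expr w K s (load_words h (addr_expr e)) =
      take_bit ((h + 1) * w) (drop_bit (c * f div w * w) (mem_val (mem s)))"
    using assms(1) superword 1 cell_pos(2)[OF assms(4)] by (rule eval_load_words)
qed

lemma pow_f_less: "2 ^ f < (2::nat) ^ (K * w)"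
  using W_ge by (intro power_strict_increasing) auto

lemma eval_cell_expr:
  assumes "regs s 3 = w" "regs s 4 = f" "eval_expr w K s e = c" "c < cells"
  shows "eval_expr w K s (cell_expr h e) = cell (mem s) c"
proof -
  let ?W = "K * w" and ?V = "mem_val (mem s)"
  let ?X = "take_bit ((h + 1) * w) (drop_bit (c * f div w * w) ?V)"
  have "eval_expr w K s (Op Shl (Const 1) (Reg 4)) = 2 ^ f"
    using assms(2) W_gt1 pow_f_less by (simp add: push_bit_eq_mult)
  then have "eval_expr w K s (cell_expr h e) =
      take_bit ?W (take_bit ?W (drop_bit (c * f mod w) ?X) mod 2 ^ f)"
    by (simp add: cell_expr_def eval_pos[OF assms])
  also have "\<dots> = cell (mem s) c"
  proof (rule bit_eqI)
    fix k
    have eq: "c * f div w * w + (c * f mod w + k) = c * f + k" by simp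
    show "bit (take_bit ?W (take_bit ?W (drop_bit (c * f mod w) ?X) mod 2 ^ f)) k =
        bit (cell (mem s) c) k"
      using cell_pos(3)[OF assms(4)] superword W_ge
      unfolding cell_def take_bit_eq_mod[symmetric] bit_take_bit_iff bit_drop_bit_eq comp_def eq
      by auto
  qed
  finally show ?thesis .
qed

text \<open>The condition \<open>p < length (mem s)\<close> accounts for a run of words that extends
  beyond the memory, where writes are lost. The induction generalizes over state, address and value
  because each round advances register 5 and shifts register 6.\<close>

lemma exec_store_words:
  assumes "regs s 3 = w" "regs s 5 = a" "regs s 6 = y" "a + j < 2 ^ (K * w)" "y < 2 ^ (K * w)"
  shows "\<exists>t s'. exec w K (store_words j) s t s' \<and> out s' = out s \<and>
      (\<forall>r. r \<noteq> 5 \<and> r \<noteq> 6 \<longrightarrow> regs s' r = regs s r) \<and> length (mem s') = length (mem s) \<and>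
      (\<forall>p. bit (mem_val (mem s')) p \<longleftrightarrow> p < length (mem s) \<and>
        (if a * w \<le> p \<and> p < (a + j + 1) * w then bit y (p - a * w) else bit (mem_val (mem s)) p))"
  using assms
proof (induction j arbitrary: s a y)
  case 0
  have "exec w K (store_words 0) s 3 (s\<lparr>mem := write_word w (mem s) a y\<rparr>)"
    using exec.Store[of w K "Reg 5" "Reg 6" s] 0 by (simp add: eval_nat_numeral)
  moreover have "bit (mem_val (write_word w (mem s) a y)) p \<longleftrightarrow> p < length (mem s) \<and>
      (if a * w \<le> p \<and> p < (a + 0 + 1) * w then bit y (p - a * w) else bit (mem_val (mem s)) p)" for p
  proof (cases "p div w = a")
    case True
    then have "p mod w = p - a * w" by (metis minus_div_mult_eq_mod)
    then show ?thesis
      using True word_index_iff[of w p a] by (simp add: bit_mem_val_write_word)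
  next
    case False
    then have "\<not> (a * w \<le> p \<and> p < (a + 0 + 1) * w)" using word_index_iff[of w p a] by simp
    with False show ?thesis unfolding bit_mem_val_write_word by presburger
  qed
  ultimately show ?case by (intro exI conjI) (assumption, simp_all)
next
  case (Suc j)
  have *: "p div w = a \<longleftrightarrow> a * w \<le> p \<and> p < (a + 1) * w" for p
    using w_pos by (intro word_index_iff) simp
  have **: "p mod w = p - a * w" if "p div w = a" for p
    using that by (metis minus_div_mult_eq_mod)
  define s1 where "s1 = s\<lparr>mem := write_word w (mem s) a y\<rparr>"
  define s2 where "s2 = s1\<lparr>regs := (regs s1)(5 := a + 1)\<rparr>"
  define s3 where "s3 = s2\<lparr>regs := (regs s2)(6 := drop_bit w y)\<rparr>"
  have dy: "drop_bit w y < 2 ^ (K * w)"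
    using Suc.prems(5) by (simp add: drop_bit_eq_div) (meson div_le_dividend le_less_trans)
  have e1: "exec w K (Store (Reg 5) (Reg 6)) s 3 s1"
    using exec.Store[of w K "Reg 5" "Reg 6" s] Suc.prems by (simp add: s1_def eval_nat_numeral)
  have e2: "exec w K (Assign 5 (Op Add (Reg 5) (Const 1))) s1 4 s2"
    using exec.Assign[of w K 5 "Op Add (Reg 5) (Const 1)" s1] Suc.prems W_gt1
    by (simp add: s1_def s2_def eval_nat_numeral)
  have e3: "exec w K (Assign 6 (Op Shr (Reg 6) (Reg 3))) s2 4 s3"
    using exec.Assign[of w K 6 "Op Shr (Reg 6) (Reg 3)" s2] Suc.prems dy
    by (simp add: s1_def s2_def s3_def eval_nat_numeral)
  have "\<exists>t s'. exec w K (store_words j) s3 t s' \<and> out s' = out s3 \<and>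
      (\<forall>r. r \<noteq> 5 \<and> r \<noteq> 6 \<longrightarrow> regs s' r = regs s3 r) \<and> length (mem s') = length (mem s3) \<and>
      (\<forall>p. bit (mem_val (mem s')) p \<longleftrightarrow> p < length (mem s3) \<and>
        (if (a + 1) * w \<le> p \<and> p < (a + 1 + j + 1) * w then bit (drop_bit w y) (p - (a + 1) * w)
         else bit (mem_val (mem s3)) p))"
    using Suc.prems dy by (intro Suc.IH) (auto simp: s1_def s2_def s3_def)
  then obtain t s' where s': "exec w K (store_words j) s3 t s'" "out s' = out s3"
      "\<forall>r. r \<noteq> 5 \<and> r \<noteq> 6 \<longrightarrow> regs s' r = regs s3 r" "length (mem s') = length (mem s3)"
      "\<And>p. bit (mem_val (mem s')) p \<longleftrightarrow> p < length (mem s3) \<and>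
        (if (a + 1) * w \<le> p \<and> p < (a + 1 + j + 1) * w then bit (drop_bit w y) (p - (a + 1) * w)
         else bit (mem_val (mem s3)) p)" by blast
  have "exec w K (store_words (Suc j)) s (3 + (4 + (4 + t))) s'"
    unfolding store_words.simps by (rule exec.Seq[OF e1 exec.Seq[OF e2 exec.Seq[OF e3 s'(1)]]])
  moreover have "bit (mem_val (mem s')) p \<longleftrightarrow> p < length (mem s) \<and>
        (if a * w \<le> p \<and> p < (a + Suc j + 1) * w then bit y (p - a * w) else bit (mem_val (mem s)) p)"
    for p
  proof -
    define A J where "A = a * w" and "J = (j + 1) * w"
    have AJ: "(a + 1) * w = A + w" "(a + 1 + j + 1) * w = A + w + J" "(a + Suc j + 1) * w = A + w + J"
      by (simp_all add: A_def J_def algebra_simps)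
    have s3: "bit (mem_val (mem s3)) p \<longleftrightarrow> p < length (mem s) \<and>
        (if A \<le> p \<and> p < A + w then bit y (p - A) else bit (mem_val (mem s)) p)"
      using *[of p] **[of p] unfolding AJ A_def[symmetric]
      by (simp add: s1_def s2_def s3_def bit_mem_val_write_word)
    have len: "length (mem s3) = length (mem s)" by (simp add: s1_def s2_def s3_def)
    consider "p < A" | "A \<le> p" "p < A + w" | "A + w \<le> p" "p < A + w + J" | "A + w + J \<le> p"
      by linarith
    then show ?thesis
      unfolding s'(5) s3 len AJ A_def[symmetric] by cases (simp_all add: bit_drop_bit_eq)
  qed
  moreover have "out s' = out s" "length (mem s') = length (mem s)"
    "\<forall>r. r \<noteq> 5 \<and> r \<noteq> 6 \<longrightarrow> regs s' r = regs s r"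
    using s' by (simp_all add: s1_def s2_def s3_def)
  ultimately show ?case by blast
qed

lemma eval_sub:
  assumes "y \<le> x" "x - y < 2 ^ (K * w)"
  shows "take_bit (K * w) (2 ^ (K * w) + x - y) = x - (y::nat)"
proof -
  \<comment> \<open>The machine adds \<open>2 ^ (K * w)\<close> in order to wrap around; without a
    borrow the reduction removes exactly this summand, and \<open>mop\<close> agrees with the
    machine.\<close>
  have "2 ^ (K * w) + x - y = (x - y) + 2 ^ (K * w)" using assms by simp
  then show ?thesis using assms(2) by (simp only: take_bit_eq_mod mod_add_self2) simp
qed

lemma eval_blocks:
  assumes "regs s 1 = n" "regs s 4 = f"
  shows "eval_expr w K s blocks_expr = N"
proof -
  have "n < 2 ^ (K * w)" using n_less pow_f_less by linarith
  moreover have "N < 2 ^ (K * w)" using N_less pow_f_less by linarith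
  moreover have "f * f < 2 ^ (K * w)"
  proof -
    have "f * f \<le> 2 ^ f * 2 ^ f" using f_less by (intro mult_mono) auto
    also have "\<dots> < 2 ^ (K * w)"
      unfolding power_add[symmetric] using W_ge by (intro power_strict_increasing) auto
    finally show ?thesis .
  qed
  moreover have "(n - 1) div (f * f) \<le> n - 1" by simp
  ultimately show ?thesis
    using assms W_gt1 n_pos by (simp add: blocks_expr_def eval_sub N_def)
qed

lemma eval_blocks_mult:
  assumes "regs s 1 = n" "regs s 4 = f" "k \<le> 3"
  shows "eval_expr w K s (blocks_mult_expr k) = N * (f + k)"
proof -
  have "N * (f + k) \<le> N * (f + 3)" using assms(3) by simp
  also have "\<dots> \<le> cells" by (simp add: cells_def algebra_simps)
  also have "\<dots> \<le> cells * f" using f_pos by simp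
  finally have 1: "N * (f + k) < 2 ^ (K * w)" using cells_bound by linarith
  moreover have "f + k \<le> N * (f + k)" using N_pos by simp
  ultimately have "f + k < 2 ^ (K * w)" by linarith
  then show ?thesis using 1 assms by (simp add: blocks_mult_expr_def eval_blocks)
qed

lemma cells_less: "cells < 2 ^ (K * w)"
proof -
  have "cells * 1 \<le> cells * f" using f_pos by (intro mult_le_mono2)
  then show ?thesis using cells_bound by linarith
qed

lemma eval_base:
  assumes "regs s 1 = n" "regs s 4 = f"
  shows "eval_expr w K s (base_expr a) = base a"
proof -
  have "N * (f + 3) + 1 < 2 ^ (K * w)" using cells_less by (simp add: cells_def algebra_simps)
  moreover have "N * (f + k) = N * f + k * N" for k by (simp add: algebra_simps)
  ultimately show ?thesis
    using assms W_gt1 by (cases a) (simp_all add: eval_blocks_mult)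
qed

lemma eval_modulus:
  assumes "regs s 4 = f"
  shows "eval_expr w K s modulus_expr = M"
proof -
  have "M < 2 ^ (K * w)" using cells_less by (simp add: cells_def)
  moreover have "f div 2 + 1 < 2 ^ (K * w)" using pow_f_less f_less f_pos by linarith
  moreover have "2 < (2::nat) ^ (K * w)" using cells_bound by linarith
  ultimately show ?thesis
    using assms W_gt1 W_ge by (simp add: modulus_expr_def M_def push_bit_eq_mult)
qed

lemma base_less: "i < size_of a \<Longrightarrow> base a + i < cells"
  by (cases a) (auto simp: cells_def)

text \<open>Disjointness of the arrays, which turns a change of one cell into an update of one entry
  of one array.\<close>

lemma base_inj: "i < size_of a \<Longrightarrow> j < size_of b \<Longrightarrow> base a + i = base b + j \<longleftrightarrow> a = b \<and> i = j"
proof -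
  assume *: "i < size_of a" "j < size_of b"
  define B where "B = N * f"
  show ?thesis
    using * unfolding base.simps by (cases a; cases b; simp add: B_def[symmetric]; linarith)
qed

lemma cell_less: "cell m c < 2 ^ f"
  by (simp add: cell_def)

lemma contents_less: "contents m a i < 2 ^ f"
  by (simp add: contents_def cell_less)

lemma mval_eq:
  assumes "sim s \<rho> \<gamma> os" "mok \<rho> \<gamma> e"
  shows "eval_expr w K s (compile_exp h e) = mval \<rho> \<gamma> e"
  using assms(2)
proof (induction e)
  case (Bin g e1 e2)
  then show ?case
    by (cases g) (auto simp: eval_sub simp del: take_bit_and take_bit_or take_bit_xor)
next
  case (Cell a e)
  have r: "regs s 1 = n" "regs s 3 = w" "regs s 4 = f" "contents (mem s) = \<gamma>"
    using assms by (auto simp: sim_def)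
  let ?i = "mval \<rho> \<gamma> e"
  have i: "?i < size_of a" "eval_expr w K s (compile_exp h e) = ?i" using Cell by auto
  note b = base_less[OF i(1)]
  have "eval_expr w K s (Op Add (base_expr a) (compile_exp h e)) = base a + ?i"
    using b cells_less i(2) eval_base[OF r(1,3)] by simp
  from eval_cell_expr[OF r(2,3) this b] show ?case
    using i r(4) by (auto simp: contents_def)
qed (use assms in \<open>auto simp: sim_def eval_modulus\<close>)

text \<open>The expressions have their values in every state related by \<open>sim\<close>, not just
  in \<open>s\<close>, because the address is evaluated once more after register 6 has been
  overwritten.\<close>

lemma exec_put_cell:
  assumes sim: "sim s \<rho> \<gamma> os"
    and e: "\<And>s. sim s \<rho> \<gamma> os \<Longrightarrow> eval_expr w K s e = base a + i" and i: "i < size_of a"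
    and v: "\<And>s. sim s \<rho> \<gamma> os \<Longrightarrow> eval_expr w K s v = x" and x: "x < 2 ^ f"
  shows "\<exists>t s'. exec w K (put_cell h e v) s t s' \<and> sim s' \<rho> (\<gamma>(a := (\<gamma> a)(i := x))) os"
proof -
  define c where "c = base a + i"
  define p where "p = c * f div w"
  define q where "q = c * f mod w"
  have pq: "p * w + q = c * f" "q < w" by (simp_all add: p_def q_def)
  have c: "c < cells" using i by (simp add: c_def base_less)
  define X where "X = take_bit ((h + 1) * w) (drop_bit (p * w) (mem_val (mem s)))"
  define Y where "Y = X XOR push_bit q (cell (mem s) c XOR x)"
  have r: "regs s 1 = n" "regs s 3 = w" "regs s 4 = f" using sim by (auto simp: sim_def)
  have bX: "bit X k \<longleftrightarrow> k < (h + 1) * w \<and> bit (mem_val (mem s)) (p * w + k)" for k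
    by (simp add: X_def bit_take_bit_iff bit_drop_bit_eq)
  have bc: "bit (cell (mem s) c) k \<longleftrightarrow> k < f \<and> bit (mem_val (mem s)) (c * f + k)" for k
    by (simp add: cell_def bit_take_bit_iff bit_drop_bit_eq)
  have bx: "bit x k \<Longrightarrow> k < f" for k
    using x by (metis bit_take_bit_iff take_bit_nat_eq_self)
  have qf: "q + f \<le> (h + 1) * w" using cell_pos(3)[OF c] by (simp add: q_def)
  have bY: "bit Y k \<longleftrightarrow> k < (h + 1) * w \<and>
      (if q \<le> k \<and> k < q + f then bit x (k - q) else bit (mem_val (mem s)) (p * w + k))" for k
  proof -
    have "c * f + (k - q) = p * w + k" if "q \<le> k" using pq(1) that by simp
    then show ?thesis
      using qf bx[of "k - q"]
      by (auto simp: Y_def bit_xor_iff bit_push_bit_iff bX bc)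
  qed
  have Yt: "take_bit ((h + 1) * w) Y = Y"
    by (rule bit_eqI) (auto simp: bit_take_bit_iff bY)
  have less: "z < 2 ^ (K * w)" if "take_bit ((h + 1) * w) z = z" for z :: nat
  proof -
    have "z < 2 ^ ((h + 1) * w)" using that by (metis take_bit_nat_less_exp)
    also have "\<dots> \<le> 2 ^ (K * w)" using superword by (intro power_increasing) auto
    finally show ?thesis .
  qed
  have "take_bit f (cell (mem s) c XOR x) = cell (mem s) c XOR x"
    using x by (simp add: take_bit_xor cell_def take_bit_nat_eq_self)
  then have xl: "cell (mem s) c XOR x < 2 ^ f" by (metis take_bit_nat_less_exp)
  have "push_bit q (cell (mem s) c XOR x) < 2 ^ (K * w)"
  proof (rule less, rule bit_eqI)
    fix k
    show "bit (take_bit ((h + 1) * w) (push_bit q (cell (mem s) c XOR x))) k =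
        bit (push_bit q (cell (mem s) c XOR x)) k"
      using qf bc[of "k - q"] bx[of "k - q"]
      by (auto simp: bit_take_bit_iff bit_push_bit_iff bit_xor_iff)
  qed
  moreover have "cell (mem s) c XOR x < 2 ^ (K * w)" using xl pow_f_less by linarith
  moreover note eval_pos[OF r(2,3) e[OF sim, folded c_def] c, folded p_def q_def X_def]
    eval_cell_expr[OF r(2,3) e[OF sim, folded c_def] c] v[OF sim] less[OF Yt]
  moreover define E where
    "E = Op Xor (load_words h (addr_expr e)) (Op Shl (Op Xor (cell_expr h e) v) (offset_expr e))"
  ultimately have eY: "eval_expr w K s E = Y"
    unfolding E_def eval_expr.simps binop_val.simps by (simp only: X_def[symmetric] Y_def[symmetric] take_bit_W)
  define s1 where "s1 = s\<lparr>regs := (regs s)(6 := Y)\<rparr>"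
  define s2 where "s2 = s1\<lparr>regs := (regs s1)(5 := p)\<rparr>"
  have sim1: "sim s1 \<rho> \<gamma> os" using sim by (auto simp: sim_def s1_def)
  have "eval_expr w K s1 (addr_expr e) = p"
    unfolding p_def using sim1 c by (intro eval_pos(1)) (auto simp: sim_def e c_def)
  then have ex: "exec w K (Assign 6 E) s (1 + cost E) s1"
    "exec w K (Assign 5 (addr_expr e)) s1 (1 + cost (addr_expr e)) s2"
    using exec.Assign[of w K 6 E s] exec.Assign[of w K 5 "addr_expr e" s1]
    by (simp_all only: s1_def s2_def eY)
  have s2: "regs s2 3 = w" "regs s2 5 = p" "regs s2 6 = Y" using r by (auto simp: s1_def s2_def)
  have "p + h < 2 ^ (K * w)" using cell_pos(2)[OF c] by (simp add: p_def)
  then obtain t s' where s': "exec w K (store_words h) s2 t s'" "out s' = out s2"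
      "\<forall>r. r \<noteq> 5 \<and> r \<noteq> 6 \<longrightarrow> regs s' r = regs s2 r" "length (mem s') = length (mem s2)"
      "\<And>k. bit (mem_val (mem s')) k \<longleftrightarrow> k < length (mem s2) \<and>
        (if p * w \<le> k \<and> k < (p + h + 1) * w then bit Y (k - p * w)
         else bit (mem_val (mem s2)) k)"
    using exec_store_words[OF s2 _ less[OF Yt]] by blast
  have len: "length (mem s) = cells * f" using sim by (simp add: sim_def)
  \<comment> \<open>Bits that share the words but lie outside the cell are written back unchanged,
    so the memory changes within the cell only.\<close>
  have ms: "bit (mem_val (mem s')) k \<longleftrightarrow> k < cells * f \<and>
      (if c * f \<le> k \<and> k < c * f + f then bit x (k - c * f) else bit (mem_val (mem s)) k)" for k
  proof -
    define P B where "P = p * w" and "B = (h + 1) * w"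
    have 1: "(p + h + 1) * w = P + B" "c * f = P + q" "q + f \<le> B" "mem s2 = mem s"
      using pq(1) qf by (simp_all add: s1_def s2_def P_def B_def algebra_simps)
    have 2: "bit (mem_val (mem s)) k \<Longrightarrow> k < length (mem s)" by (simp add: bit_mem_val)
    show ?thesis
    proof (cases "P \<le> k \<and> k < P + B")
      case True
      then obtain k' where k': "k = P + k'" "k' < B" by (metis add_less_cancel_left le_iff_add)
      then show ?thesis
        using 1(3) len unfolding s'(5) bY 1(1,2,4) P_def[symmetric] B_def[symmetric] by simp
    next
      case False
      then have "\<not> (P + q \<le> k \<and> k < P + q + f)" using 1(3) by linarith
      then show ?thesis
        using False len 2 unfolding s'(5) 1(1,2,4) P_def[symmetric] by auto
    qed
  qed
  have "cell (mem s') c' = (if c' = c then x else cell (mem s) c')" if "c' < cells" for c'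
  proof (rule bit_eqI)
    fix k
    \<comment> \<open>Cells are words of length \<open>f\<close> in the sense of
      \<open>word_index_iff\<close>.\<close>
    have "c * f \<le> c' * f + k \<and> c' * f + k < c * f + f \<longleftrightarrow> c' = c" if "k < f"
      using word_index_iff[of f "c' * f + k" c] that by (auto simp: algebra_simps)
    moreover have "c' * f + k < cells * f" if "k < f"
    proof -
      have "c' * f + k < (c' + 1) * f" using that by simp
      also have "\<dots> \<le> cells * f" using \<open>c' < cells\<close> by (intro mult_le_mono1) simp
      finally show ?thesis .
    qed
    ultimately show "bit (cell (mem s') c') k = bit (if c' = c then x else cell (mem s) c') k"
      using bx[of k] by (auto simp: cell_def bit_take_bit_iff bit_drop_bit_eq ms)
  qed
  then have cell: "cell (mem s') (base b + j) = (if b = a \<and> j = i then x else cell (mem s) (base b + j))"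
    if "j < size_of b" for b j
    using that base_less[OF that] base_inj[OF that i] by (simp add: c_def)
  have "contents (mem s') b j = ((contents (mem s))(a := (contents (mem s) a)(i := x))) b j" for b j
    using i cell[of j b] unfolding contents_def by (cases "b = a"; cases "j = i") simp_all
  then have "contents (mem s') = (contents (mem s))(a := (contents (mem s) a)(i := x))"
    by blast
  then have "sim s' \<rho> (\<gamma>(a := (\<gamma> a)(i := x))) os"
    using sim s' by (auto simp: sim_def s1_def s2_def)
  moreover have "exec w K (put_cell h e v) s (1 + cost E + (1 + cost (addr_expr e) + t)) s'"
    unfolding put_cell_def E_def[symmetric] by (rule exec.Seq[OF ex(1) exec.Seq[OF ex(2) s'(1)]])
  ultimately show ?thesis by blast
qed

section \<open>Weakest preconditions for the loop-free language\<close>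

fun wp where
  "wp Nop Q \<rho> \<gamma> os = Q \<rho> \<gamma> os"
| "wp (Asg x e) Q \<rho> \<gamma> os = (mok \<rho> \<gamma> e \<and> Q (\<rho>(x := mval \<rho> \<gamma> e)) \<gamma> os)"
| "wp (Put a i e) Q \<rho> \<gamma> os = (mok \<rho> \<gamma> i \<and> mok \<rho> \<gamma> e \<and> mval \<rho> \<gamma> i < size_of a \<and> mval \<rho> \<gamma> e < 2 ^ f \<and>
     Q \<rho> (\<gamma>(a := (\<gamma> a)(mval \<rho> \<gamma> i := mval \<rho> \<gamma> e))) os)"
| "wp (Out e) Q \<rho> \<gamma> os = (mok \<rho> \<gamma> e \<and> Q \<rho> \<gamma> (os @ [mval \<rho> \<gamma> e]))"
| "wp (Then c d) Q \<rho> \<gamma> os = wp c (wp d Q) \<rho> \<gamma> os"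
| "wp (Cond e c d) Q \<rho> \<gamma> os = (mok \<rho> \<gamma> e \<and>
     (mval \<rho> \<gamma> e \<noteq> 0 \<longrightarrow> wp c Q \<rho> \<gamma> os) \<and> (mval \<rho> \<gamma> e = 0 \<longrightarrow> wp d Q \<rho> \<gamma> os))"

text \<open>The final state is obtained by induction on the program; the time bound needs no
  induction here, as compiled code is loop-free and obeys \<open>max_time\<close>.\<close>

lemma wp_sound:
  assumes "sim s \<rho> \<gamma> os" "wp c Q \<rho> \<gamma> os"
  shows "\<exists>t s' \<rho>' \<gamma>' os'. exec w K (compile h c) s t s' \<and> t \<le> max_time (compile h c) \<and>
    sim s' \<rho>' \<gamma>' os' \<and> Q \<rho>' \<gamma>' os'"
proof -
  have "\<exists>t s' \<rho>' \<gamma>' os'. exec w K (compile h c) s t s' \<and> sim s' \<rho>' \<gamma>' os' \<and> Q \<rho>' \<gamma>' os'"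
    using assms
  proof (induction c arbitrary: Q s \<rho> \<gamma> os)
    case Nop
    then show ?case using exec.Skip[of w K s] by (simp, blast)
  next
    case (Asg x e)
    then have "eval_expr w K s (compile_exp h e) = mval \<rho> \<gamma> e" by (auto intro: mval_eq)
    then have "exec w K (compile h (Asg x e)) s (1 + cost (compile_exp h e))
        (s\<lparr>regs := (regs s)(x + 7 := mval \<rho> \<gamma> e)\<rparr>)"
      using exec.Assign[of w K "x + 7" "compile_exp h e" s] by simp
    moreover have "sim (s\<lparr>regs := (regs s)(x + 7 := mval \<rho> \<gamma> e)\<rparr>) (\<rho>(x := mval \<rho> \<gamma> e)) \<gamma> os"
      using Asg.prems(1) by (auto simp: sim_def)
    ultimately show ?case using Asg.prems(2) unfolding compile.simps wp.simps by blast
  next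
    case (Put a i e)
    let ?i = "mval \<rho> \<gamma> i"
    have "eval_expr w K s (Op Add (base_expr a) (compile_exp h i)) = base a + ?i"
      if "sim s \<rho> \<gamma> os" for s
      using that Put.prems(2) base_less[of ?i a] cells_less eval_base[of s a] mval_eq[of s \<rho> \<gamma> os i]
      by (auto simp: sim_def)
    from exec_put_cell[OF Put.prems(1) this, where v = "compile_exp h e" and x = "mval \<rho> \<gamma> e"]
    obtain t s' where "exec w K (compile h (Put a i e)) s t s'"
      "sim s' \<rho> (\<gamma>(a := (\<gamma> a)(?i := mval \<rho> \<gamma> e))) os"
      using Put.prems(2) mval_eq by auto
    moreover have "Q \<rho> (\<gamma>(a := (\<gamma> a)(?i := mval \<rho> \<gamma> e))) os" using Put.prems(2) by simp
    ultimately show ?case by blast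
  next
    case (Out e)
    then have "eval_expr w K s (compile_exp h e) = mval \<rho> \<gamma> e" by (auto intro: mval_eq)
    then have "exec w K (compile h (Out e)) s (1 + cost (compile_exp h e))
        (s\<lparr>out := out s @ [mval \<rho> \<gamma> e]\<rparr>)"
      using exec.Emit[of w K "compile_exp h e" s] by simp
    moreover have "sim (s\<lparr>out := out s @ [mval \<rho> \<gamma> e]\<rparr>) \<rho> \<gamma> (os @ [mval \<rho> \<gamma> e])"
      using Out.prems(1) by (auto simp: sim_def)
    ultimately show ?case using Out.prems(2) unfolding compile.simps wp.simps by blast
  next
    case (Then c d)
    from Then.prems(2) have "wp c (wp d Q) \<rho> \<gamma> os" by simp
    from Then.IH(1)[OF Then.prems(1) this] obtain t s' \<rho>' \<gamma>' os' where
      1: "exec w K (compile h c) s t s'" "sim s' \<rho>' \<gamma>' os'" "wp d Q \<rho>' \<gamma>' os'" by blast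
    from Then.IH(2)[OF 1(2,3)] obtain u s'' \<rho>'' \<gamma>'' os'' where
      2: "exec w K (compile h d) s' u s''" "sim s'' \<rho>'' \<gamma>'' os''" "Q \<rho>'' \<gamma>'' os''" by blast
    have "exec w K (compile h (Then c d)) s (t + u) s''" using exec.Seq[OF 1(1) 2(1)] by simp
    with 2 show ?case by blast
  next
    case (Cond e c d)
    then have e: "eval_expr w K s (compile_exp h e) = mval \<rho> \<gamma> e" by (auto intro: mval_eq)
    show ?case
    proof (cases "mval \<rho> \<gamma> e = 0")
      case True
      then have "wp d Q \<rho> \<gamma> os" using Cond.prems(2) by simp
      from Cond.IH(2)[OF Cond.prems(1) this] obtain t s' \<rho>' \<gamma>' os' where
        1: "exec w K (compile h d) s t s'" "sim s' \<rho>' \<gamma>' os'" "Q \<rho>' \<gamma>' os'" by blast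
      have "exec w K (compile h (Cond e c d)) s (1 + cost (compile_exp h e) + t) s'"
        unfolding compile.simps using e True 1(1) by (intro exec.IfFalse) simp_all
      with 1 show ?thesis by blast
    next
      case False
      then have "wp c Q \<rho> \<gamma> os" using Cond.prems(2) by simp
      from Cond.IH(1)[OF Cond.prems(1) this] obtain t s' \<rho>' \<gamma>' os' where
        1: "exec w K (compile h c) s t s'" "sim s' \<rho>' \<gamma>' os'" "Q \<rho>' \<gamma>' os'" by blast
      have "exec w K (compile h (Cond e c d)) s (1 + cost (compile_exp h e) + t) s'"
        unfolding compile.simps using e False 1(1) by (intro exec.IfTrue) simp_all
      with 1 show ?thesis by blast
    qed
  qed
  then obtain t s' \<rho>' \<gamma>' os' where
    1: "exec w K (compile h c) s t s'" "sim s' \<rho>' \<gamma>' os'" "Q \<rho>' \<gamma>' os'" by blast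
  from exec_max_time[OF 1(1) loopfree_compile] 1 show ?thesis by blast
qed

end

section \<open>The operations\<close>

text \<open>
  Variables: 0 argument and result, 2 leaf, 9 bit in the leaf, 4 block, 3 leaf within the block,
  5 position in \<open>Lst\<close>, 6 summary, 7 leaf contents, 8 scratch.  After \<open>locate\<close>, variables 6 and 7 are 0
  whenever the block or leaf is not valid.
\<close>

definition test_bit_exp :: "mexp \<Rightarrow> mexp \<Rightarrow> mexp" where
  "test_bit_exp a b = Bin Conj (Bin Shr a b) (Num 1)"

definition power2_exp :: "mexp \<Rightarrow> mexp" where
  "power2_exp e = Bin Shl (Num 1) e"

definition cnt_exp :: mexp where "cnt_exp = Cell Cnt (Num 0)"

text \<open>Bit positions count from 0, elements from 1.\<close>

definition elem_exp :: mexp where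
  "elem_exp = Bin Add (Bin Add (Bin Mul (Var 2) Width) (Var 9)) (Num 1)"

text \<open>Variable \<open>s\<close> is left with the remaining bits, so that repeated use runs
  through all of them.\<close>

definition take_low :: "nat \<Rightarrow> nat \<Rightarrow> mcom" where
  "take_low s k = Then (Asg 8 (Bin Conj (Var s) (Bin Sub (Var s) (Num 1))))
     (Then (Asg k (Cell Tab (Bin Rem (Bin Xor (Var s) (Var 8)) Modulus))) (Asg s (Var 8)))"

text \<open>The entry of \<open>Pos\<close> may be stale; comparing it with the count before
  following it keeps the access to \<open>Lst\<close> within the array.\<close>

definition locate :: mcom where
  "locate = Then (Asg 8 (Bin Sub (Var 0) (Num 1))) (Then (Asg 2 (Bin Quot (Var 8) Width))
     (Then (Asg 9 (Bin Rem (Var 8) Width)) (Then (Asg 4 (Bin Quot (Var 2) Width))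
     (Then (Asg 3 (Bin Rem (Var 2) Width)) (Then (Asg 5 (Cell Pos (Var 4)))
     (Then (Asg 6 (Num 0)) (Then (Cond (Bin Less (Var 5) cnt_exp)
       (Cond (Bin Equal (Cell Lst (Var 5)) (Var 4)) (Asg 6 (Cell Summ (Var 4))) Nop) Nop)
     (Then (Asg 7 (Num 0)) (Cond (test_bit_exp (Var 6) (Var 3)) (Asg 7 (Cell Leaf (Var 2))) Nop)))))))))"

definition learn :: "nat \<Rightarrow> mcom" where
  "learn k = Put Tab (Bin Rem (power2_exp (Var k)) Modulus) (Var k)"

text \<open>The new summary and leaf are built from variables 6 and 7 rather than from the stored
  cells: these are 0 for a block or leaf not in use, so stale contents are discarded. The count is
  incremented last because its old value is the new list position.\<close>

definition insert_com :: mcom where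
  "insert_com = Then locate (Then (learn 9) (Then (learn 3)
     (Then (Cond (Var 6) Nop (Then (Put Lst cnt_exp (Var 4)) (Then (Put Pos (Var 4) cnt_exp)
       (Put Cnt (Num 0) (Bin Add cnt_exp (Num 1))))))
     (Then (Put Summ (Var 4) (Bin Disj (Var 6) (power2_exp (Var 3))))
       (Put Leaf (Var 2) (Bin Disj (Var 7) (power2_exp (Var 9))))))))"

text \<open>The count is decremented before \<open>Lst\<close> is read, so that its new value is the
  position of the last block, which fills the gap.\<close>

definition delete_com :: mcom where
  "delete_com = Then locate (Cond (test_bit_exp (Var 7) (Var 9))
     (Then (Asg 7 (Bin Xor (Var 7) (power2_exp (Var 9))))
     (Then (Put Leaf (Var 2) (Var 7))
     (Cond (Var 7) Nop
       (Then (Asg 6 (Bin Xor (Var 6) (power2_exp (Var 3))))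
       (Then (Put Summ (Var 4) (Var 6))
       (Cond (Var 6) Nop
         (Then (Put Cnt (Num 0) (Bin Sub cnt_exp (Num 1)))
         (Then (Asg 8 (Cell Lst cnt_exp))
         (Then (Put Lst (Var 5) (Var 8)) (Put Pos (Var 8) (Var 5)))))))))))
     Nop)"

definition search_com :: mcom where
  "search_com = Then locate (Asg 0 (test_bit_exp (Var 7) (Var 9)))"

definition next_leaf :: mcom where
  "next_leaf = Then (take_low 6 3)
     (Then (Asg 2 (Bin Add (Bin Mul (Var 4) Width) (Var 3))) (Asg 7 (Cell Leaf (Var 2))))"

definition findany_com :: mcom where
  "findany_com = Cond cnt_exp
     (Then (Asg 4 (Cell Lst (Num 0))) (Then (Asg 6 (Cell Summ (Var 4)))
       (Then next_leaf (Then (take_low 7 9) (Asg 0 elem_exp)))))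
     (Asg 0 (Num 0))"

definition init_com :: mcom where
  "init_com = Put Cnt (Num 0) (Num 0)"

definition start_com :: mcom where
  "start_com = Then (Asg 5 (Num 0)) (Then (Asg 6 (Num 0)) (Asg 7 (Num 0)))"

definition pending_exp :: mexp where
  "pending_exp = Bin Disj (Bin Less (Var 5) cnt_exp) (Bin Disj (Var 6) (Var 7))"

definition next_block :: mcom where
  "next_block = Then (Asg 4 (Cell Lst (Var 5)))
     (Then (Asg 5 (Bin Add (Var 5) (Num 1))) (Asg 6 (Cell Summ (Var 4))))"

text \<open>Every iteration outputs an element, since the leaves and blocks visited are never empty.\<close>

definition emit_com :: mcom where
  "emit_com = Then (Cond (Var 7) Nop (Then (Cond (Var 6) Nop next_block) next_leaf))
     (Then (take_low 7 9) (Out elem_exp))"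

lemma bit_less_exp: "x < 2 ^ m \<Longrightarrow> bit x k \<Longrightarrow> k < m" for x :: nat
  by (metis bit_take_bit_iff take_bit_nat_eq_self)

lemma or_less_exp: "x < 2 ^ m \<Longrightarrow> y < 2 ^ m \<Longrightarrow> x OR y < 2 ^ m" for x y :: nat
  by (metis take_bit_nat_eq_self_iff take_bit_or)

lemma xor_less_exp: "x < 2 ^ m \<Longrightarrow> y < 2 ^ m \<Longrightarrow> x XOR y < 2 ^ m" for x y :: nat
  by (metis take_bit_nat_eq_self_iff take_bit_xor)

lemma and_less_exp: "x < 2 ^ m \<Longrightarrow> x AND y < 2 ^ m" for x y :: nat
  by (rule take_bit_nat_eq_self_iff[THEN iffD1], rule bit_eqI)
    (auto simp: bit_take_bit_iff bit_and_iff dest: bit_less_exp)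

lemma div_mod_eqI: "a div f = b div f \<Longrightarrow> a mod f = b mod f \<Longrightarrow> a = b" for a b f :: nat
  by (metis div_mult_mod_eq)

lemma or_power2_pos: "0 < x OR 2 ^ k" for x :: nat
  by (rule gr0I, drule arg_cong[where f = "\<lambda>z. bit z k"]) (simp add: bit_or_iff bit_exp_iff)

section \<open>The invariant and its preservation\<close>

context layout
begin

definition active where
  "active \<gamma> q \<longleftrightarrow> \<gamma> Pos q < \<gamma> Cnt 0 \<and> \<gamma> Lst (\<gamma> Pos q) = q"

text \<open>What remains after the tests of \<open>locate\<close>: stale cells read as 0. For
  summaries and leaves the invariant speaks of these values instead of the raw cells.\<close>

definition summ :: "(arr \<Rightarrow> nat \<Rightarrow> nat) \<Rightarrow> nat \<Rightarrow> nat" where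
  "summ \<gamma> q = (if active \<gamma> q then \<gamma> Summ q else 0)"

definition leaf :: "(arr \<Rightarrow> nat \<Rightarrow> nat) \<Rightarrow> nat \<Rightarrow> nat" where
  "leaf \<gamma> g = (if bit (summ \<gamma> (g div f)) (g mod f) then \<gamma> Leaf g else 0)"

definition knows :: "(arr \<Rightarrow> nat \<Rightarrow> nat) \<Rightarrow> nat \<Rightarrow> bool" where
  "knows \<gamma> k \<longleftrightarrow> \<gamma> Tab (2 ^ k mod M) = k"

text \<open>The back pointers force \<open>Lst\<close> to be injective below the count; the other
  entries of \<open>Pos\<close> stay arbitrary.\<close>

definition sparse :: "(arr \<Rightarrow> nat \<Rightarrow> nat) \<Rightarrow> bool" where
  "sparse \<gamma> \<longleftrightarrow> \<gamma> Cnt 0 \<le> N \<and> (\<forall>p<\<gamma> Cnt 0. \<gamma> Lst p < N \<and> \<gamma> Pos (\<gamma> Lst p) = p)"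

text \<open>The two nonemptiness conditions let \<open>findany\<close> descend without searching and
  let enumeration pay for each block and leaf with an element. The conditions on
  \<open>knows\<close> cover exactly the bits that can ever be isolated.\<close>

definition valid :: "(arr \<Rightarrow> nat \<Rightarrow> nat) \<Rightarrow> nat set \<Rightarrow> bool" where
  "valid \<gamma> S \<longleftrightarrow> S \<subseteq> {1..n} \<and> (\<forall>a i. \<gamma> a i < 2 ^ f) \<and> sparse \<gamma> \<and>
     (\<forall>q. active \<gamma> q \<longrightarrow> summ \<gamma> q \<noteq> 0) \<and>
     (\<forall>g. bit (summ \<gamma> (g div f)) (g mod f) \<longrightarrow> leaf \<gamma> g \<noteq> 0) \<and>
     (\<forall>j. Suc j \<in> S \<longleftrightarrow> bit (leaf \<gamma> (j div f)) (j mod f)) \<and>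
     (\<forall>q k. bit (summ \<gamma> q) k \<longrightarrow> knows \<gamma> k) \<and> (\<forall>g k. bit (leaf \<gamma> g) k \<longrightarrow> knows \<gamma> k)"

lemma validI:
  assumes "S \<subseteq> {1..n}" "\<And>a i. \<gamma> a i < 2 ^ f" "sparse \<gamma>"
    "\<And>q. active \<gamma> q \<Longrightarrow> summ \<gamma> q \<noteq> 0"
    "\<And>g. bit (summ \<gamma> (g div f)) (g mod f) \<Longrightarrow> leaf \<gamma> g \<noteq> 0"
    "\<And>j. Suc j \<in> S \<longleftrightarrow> bit (leaf \<gamma> (j div f)) (j mod f)"
    "\<And>q k. bit (summ \<gamma> q) k \<Longrightarrow> knows \<gamma> k" "\<And>g k. bit (leaf \<gamma> g) k \<Longrightarrow> knows \<gamma> k"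
  shows "valid \<gamma> S"
  using assms unfolding valid_def by blast

lemma validD:
  assumes "valid \<gamma> S"
  shows "S \<subseteq> {1..n}" "\<gamma> a i < 2 ^ f" "sparse \<gamma>"
    "active \<gamma> q \<Longrightarrow> summ \<gamma> q \<noteq> 0"
    "bit (summ \<gamma> (g div f)) (g mod f) \<Longrightarrow> leaf \<gamma> g \<noteq> 0"
    "Suc j \<in> S \<longleftrightarrow> bit (leaf \<gamma> (j div f)) (j mod f)"
    "bit (summ \<gamma> q) k \<Longrightarrow> knows \<gamma> k" "bit (leaf \<gamma> g) k \<Longrightarrow> knows \<gamma> k"
  using assms unfolding valid_def by blast+

lemma summ_leaf_less:
  assumes "valid \<gamma> S"
  shows "summ \<gamma> q < 2 ^ f" "leaf \<gamma> g < 2 ^ f"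
  using validD(2)[OF assms] by (auto simp: summ_def leaf_def)

lemma M_gt: "0 < M" "x mod M < M"
  by (simp_all add: M_def)

text \<open>The exponent \<open>f div 2 + 1\<close> in \<open>M\<close> is the least
  \<open>a\<close> with \<open>2 * a > f\<close>.\<close>

lemma tab_inj: "i < f \<Longrightarrow> j < f \<Longrightarrow> 2 ^ i mod M = 2 ^ j mod M \<Longrightarrow> i = j"
  unfolding M_def by (rule inj_power2_mod[of i "f div 2 + 1"]) auto

lemma active_less: "sparse \<gamma> \<Longrightarrow> active \<gamma> q \<Longrightarrow> q < N"
  unfolding sparse_def active_def by metis

lemma active_Lst: "sparse \<gamma> \<Longrightarrow> p < \<gamma> Cnt 0 \<Longrightarrow> active \<gamma> (\<gamma> Lst p)"
  by (simp add: sparse_def active_def)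

lemma leaf_active:
  assumes "bit (leaf \<gamma> g) k"
  shows "bit (summ \<gamma> (g div f)) (g mod f)" "active \<gamma> (g div f)" "leaf \<gamma> g = \<gamma> Leaf g"
  using assms by (auto simp: leaf_def summ_def split: if_splits)

lemma div_mod_f: "l < f \<Longrightarrow> (q * f + l) div f = q \<and> (q * f + l) mod f = l"
  using f_pos by simp

lemma div_mod_f_iff: "l < f \<Longrightarrow> g = q * f + l \<longleftrightarrow> g div f = q \<and> g mod f = l"
  using f_pos by (metis div_mod_f div_mult_mod_eq)

lemma mod_f_less: "x mod f < f" using f_pos by simp

text \<open>Writing an entry could spoil another one only if two powers had the same residue, which
  \<open>tab_inj\<close> excludes; the set itself is not encoded in the table.\<close>

lemma valid_learn:
  assumes "valid \<gamma> S" "k < f"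
  defines "\<gamma>' \<equiv> \<gamma>(Tab := (\<gamma> Tab)(2 ^ k mod M := k))"
  shows "valid \<gamma>' S" "knows \<gamma>' k" "\<And>l. l < f \<Longrightarrow> knows \<gamma> l \<Longrightarrow> knows \<gamma>' l"
    "active \<gamma>' = active \<gamma>" "summ \<gamma>' = summ \<gamma>" "leaf \<gamma>' = leaf \<gamma>"
proof -
  show kn: "knows \<gamma>' k" by (simp add: \<gamma>'_def knows_def)
  show kn': "knows \<gamma>' l" if "l < f" "knows \<gamma> l" for l
    using that tab_inj[of l k] assms(2) by (auto simp: \<gamma>'_def knows_def)
  show 1: "active \<gamma>' = active \<gamma>" by (auto simp: active_def \<gamma>'_def fun_eq_iff)
  then show 2: "summ \<gamma>' = summ \<gamma>" by (auto simp: summ_def \<gamma>'_def fun_eq_iff)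
  then show 3: "leaf \<gamma>' = leaf \<gamma>" by (auto simp: leaf_def \<gamma>'_def fun_eq_iff)
  note D = validD[OF assms(1)]
  have "k < 2 ^ f" using assms(2) f_less by (rule less_trans)
  then have "\<gamma>' a i < 2 ^ f" for a i using D(2) by (simp add: \<gamma>'_def)
  moreover have "sparse \<gamma>'" using D(3) by (simp add: sparse_def \<gamma>'_def)
  ultimately show "valid \<gamma>' S"
    using D kn' bit_less_exp[OF summ_leaf_less(1)[OF assms(1)]] bit_less_exp[OF summ_leaf_less(2)[OF assms(1)]]
    by (intro validI) (simp_all add: 1 2 3)
qed

section \<open>Adding and removing blocks and elements\<close>

lemma sparseD:
  assumes "sparse \<gamma>" "p < \<gamma> Cnt 0"
  shows "\<gamma> Lst p < N" "\<gamma> Pos (\<gamma> Lst p) = p"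
  using assms by (simp_all add: sparse_def)

text \<open>Pigeonhole: the listed blocks are distinct, lie below \<open>N\<close> and omit
  \<open>q\<close>. Hence \<open>Lst\<close> has room for one more entry.\<close>

lemma cnt_less:
  assumes "sparse \<gamma>" "\<not> active \<gamma> q" "q < N"
  shows "\<gamma> Cnt 0 < N"
proof -
  let ?A = "\<gamma> Lst ` {..<\<gamma> Cnt 0}"
  have "inj_on (\<gamma> Lst) {..<\<gamma> Cnt 0}"
    using sparseD(2)[OF assms(1)] by (intro inj_on_inverseI[where g = "\<gamma> Pos"]) simp
  then have "card ?A = \<gamma> Cnt 0" by (simp add: card_image)
  moreover have "q \<notin> ?A" using active_Lst[OF assms(1)] assms(2) by auto
  then have "?A \<subset> {..<N}" using sparseD(1)[OF assms(1)] assms(3) by auto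
  then have "card ?A < card {..<N}" by (intro psubset_card_mono) auto
  ultimately show ?thesis by simp
qed

definition activate :: "(arr \<Rightarrow> nat \<Rightarrow> nat) \<Rightarrow> nat \<Rightarrow> arr \<Rightarrow> nat \<Rightarrow> nat" where
  "activate \<gamma> q = (if active \<gamma> q then \<gamma>
     else \<gamma>(Lst := (\<gamma> Lst)(\<gamma> Cnt 0 := q), Pos := (\<gamma> Pos)(q := \<gamma> Cnt 0),
       Cnt := (\<gamma> Cnt)(0 := \<gamma> Cnt 0 + 1)))"

lemma activate:
  assumes "sparse \<gamma>" "q < N"
  shows "sparse (activate \<gamma> q)" "active (activate \<gamma> q) q' \<longleftrightarrow> active \<gamma> q' \<or> q' = q"
proof -
  show "sparse (activate \<gamma> q)"
  proof (cases "active \<gamma> q")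
    case False
    let ?\<gamma> = "activate \<gamma> q"
    have val: "?\<gamma> Cnt 0 = Suc (\<gamma> Cnt 0)" "?\<gamma> Lst = (\<gamma> Lst)(\<gamma> Cnt 0 := q)"
      "?\<gamma> Pos = (\<gamma> Pos)(q := \<gamma> Cnt 0)"
      using False by (simp_all add: activate_def)
    have "?\<gamma> Lst p < N \<and> ?\<gamma> Pos (?\<gamma> Lst p) = p" if "p < Suc (\<gamma> Cnt 0)" for p
    proof (cases "p = \<gamma> Cnt 0")
      case True
      then show ?thesis using assms(2) by (simp add: val)
    next
      case np: False
      then have p: "p < \<gamma> Cnt 0" using that by simp
      moreover have "\<gamma> Lst p \<noteq> q" using False active_Lst[OF assms(1) p] by auto
      ultimately show ?thesis using sparseD[OF assms(1) p] np by (simp add: val)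
    qed
    then show ?thesis
      using cnt_less[OF assms(1) False assms(2)] unfolding sparse_def val(1) by simp
  qed (use assms(1) in \<open>simp add: activate_def\<close>)
  show "active (activate \<gamma> q) q' \<longleftrightarrow> active \<gamma> q' \<or> q' = q"
  proof (cases "active \<gamma> q \<or> q' = q")
    case True
    then show ?thesis by (auto simp: activate_def active_def)
  next
    case False
    \<comment> \<open>A stale back pointer of \<open>q'\<close> may happen to equal the old count
      and so come into range; it is then refuted by \<open>Lst\<close>, which holds \<open>q\<close>
      there.\<close>
    then show ?thesis by (cases "\<gamma> Pos q' = \<gamma> Cnt 0") (auto simp: activate_def active_def)
  qed
qed

text \<open>The table has to know both bit positions already, which is why \<open>insert_com\<close>
  runs \<open>learn\<close> before it sets a bit.\<close>

lemma valid_insert: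
  assumes "valid \<gamma> S" "j < n" and k: "knows \<gamma> (j mod f)" and l: "knows \<gamma> (j div f mod f)"
  defines "g \<equiv> j div f"
  defines "q \<equiv> g div f"
  defines "\<gamma>' \<equiv> (activate \<gamma> q)(Summ := (\<gamma> Summ)(q := summ \<gamma> q OR 2 ^ (g mod f)),
    Leaf := (\<gamma> Leaf)(g := leaf \<gamma> g OR 2 ^ (j mod f)))"
  shows "valid \<gamma>' (S \<union> {Suc j})"
proof -
  note D = validD[OF assms(1)]
  have q: "q < N" using cover(2)[OF assms(2)] by (simp add: q_def g_def)
  note A = activate[OF D(3) q]
  have act: "active \<gamma>' q' \<longleftrightarrow> active \<gamma> q' \<or> q' = q" for q'
    unfolding A(2)[symmetric] by (simp add: active_def \<gamma>'_def)
  have tab: "knows \<gamma>' = knows \<gamma>" by (simp add: fun_eq_iff knows_def \<gamma>'_def activate_def)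
  have Summ: "\<gamma>' Summ q' = (if q' = q then summ \<gamma> q OR 2 ^ (g mod f) else \<gamma> Summ q')"
    and Leaf: "\<gamma>' Leaf g' = (if g' = g then leaf \<gamma> g OR 2 ^ (j mod f) else \<gamma> Leaf g')" for q' g'
    by (simp_all add: \<gamma>'_def activate_def)
  have sum: "summ \<gamma>' q' = (if q' = q then summ \<gamma> q OR 2 ^ (g mod f) else summ \<gamma> q')" for q'
    unfolding summ_def[of \<gamma>'] act Summ by (simp add: summ_def)
  \<comment> \<open>A leaf is determined by its block and its place therein, so that among all
    leaves only \<open>g\<close> sees its summary bit change.\<close>
  have ne: "\<not> (g' div f = q \<and> g' mod f = g mod f)" if "g' \<noteq> g" for g'
    using that unfolding q_def using div_mod_eqI by blast
  have bsum: "bit (summ \<gamma>' (g' div f)) (g' mod f) \<longleftrightarrow>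
      bit (summ \<gamma> (g' div f)) (g' mod f) \<or> g' = g" for g'
    using ne[of g'] by (auto simp: sum bit_or_iff bit_exp_iff q_def)
  have lf: "leaf \<gamma>' g' = (if g' = g then leaf \<gamma> g OR 2 ^ (j mod f) else leaf \<gamma> g')" for g'
    unfolding leaf_def[of \<gamma>'] bsum Leaf by (simp add: leaf_def)
  have g0: "2 ^ (x mod f) < (2::nat) ^ f" for x using mod_f_less[of x] by simp
  show ?thesis
  proof (rule validI)
    show "S \<union> {Suc j} \<subseteq> {1..n}" using D(1) assms(2) by auto
    have "\<gamma> Cnt 0 + 1 < 2 ^ f" if "\<not> active \<gamma> q"
      using cnt_less[OF D(3) that q] N_less by simp
    moreover have "q < 2 ^ f" using q N_less by simp
    ultimately show "\<gamma>' a i < 2 ^ f" for a i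
      using D(2) g0 summ_leaf_less[OF assms(1)] by (auto simp: \<gamma>'_def activate_def or_less_exp)
    show "sparse \<gamma>'" using A(1) by (simp add: sparse_def \<gamma>'_def)
    show "summ \<gamma>' q' \<noteq> 0" if "active \<gamma>' q'" for q'
      using that D(4) unfolding act sum by (auto simp: or_power2_pos)
    show "leaf \<gamma>' g' \<noteq> 0" if "bit (summ \<gamma>' (g' div f)) (g' mod f)" for g'
      using that D(5) unfolding bsum lf by (auto simp: or_power2_pos)
    show "Suc j' \<in> S \<union> {Suc j} \<longleftrightarrow> bit (leaf \<gamma>' (j' div f)) (j' mod f)" for j'
    proof -
      have "j' = j \<longleftrightarrow> j' div f = g \<and> j' mod f = j mod f" unfolding g_def using div_mod_eqI by blast
      then show ?thesis using D(6)[of j'] by (auto simp: lf bit_or_iff bit_exp_iff)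
    qed
    show "knows \<gamma>' k'" if "bit (summ \<gamma>' q') k'" for q' k'
      using that D(7) l by (auto simp: tab sum bit_or_iff bit_exp_iff g_def split: if_splits)
    show "knows \<gamma>' k'" if "bit (leaf \<gamma>' g') k'" for g' k'
      using that D(8) k by (auto simp: tab lf bit_or_iff bit_exp_iff split: if_splits)
  qed
qed

text \<open>The last block of the list moves into the gap. If \<open>q\<close> itself is last, the
  two pointer updates rewrite old values and only the smaller count removes it.\<close>

definition deactivate :: "(arr \<Rightarrow> nat \<Rightarrow> nat) \<Rightarrow> nat \<Rightarrow> arr \<Rightarrow> nat \<Rightarrow> nat" where
  "deactivate \<gamma> q = \<gamma>(Cnt := (\<gamma> Cnt)(0 := \<gamma> Cnt 0 - 1),
     Lst := (\<gamma> Lst)(\<gamma> Pos q := \<gamma> Lst (\<gamma> Cnt 0 - 1)),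
     Pos := (\<gamma> Pos)(\<gamma> Lst (\<gamma> Cnt 0 - 1) := \<gamma> Pos q))"

lemma deactivate:
  assumes "sparse \<gamma>" "active \<gamma> q"
  shows "sparse (deactivate \<gamma> q)" "active (deactivate \<gamma> q) q' \<longleftrightarrow> active \<gamma> q' \<and> q' \<noteq> q"
proof -
  define c where "c = \<gamma> Cnt 0 - 1"
  have c: "\<gamma> Cnt 0 = Suc c" using assms(2) by (simp add: c_def active_def)
  have L: "\<gamma> Lst p < N" "\<gamma> Pos (\<gamma> Lst p) = p" if "p < Suc c" for p
    using assms(1) that by (auto simp: sparse_def c)
  have q: "\<gamma> Pos q < Suc c" "\<gamma> Lst (\<gamma> Pos q) = q" using assms(2) by (auto simp: active_def c)
  show "sparse (deactivate \<gamma> q)"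
  proof -
    have "c \<le> N" using assms(1) by (simp add: sparse_def c)
    \<comment> \<open>Only the pointer of the moved block is redirected; the back pointers of the
      other remaining entries are untouched.\<close>
    moreover have "\<gamma> Lst p \<noteq> \<gamma> Lst c" if "p < c" for p using L(2)[of p] L(2)[of c] that by auto
    ultimately show ?thesis
      using L q by (auto simp: sparse_def deactivate_def c)
  qed
  have "\<gamma> Pos (\<gamma> Lst c) = c" "\<gamma> Lst c < N" using L[of c] by simp_all
  then show "active (deactivate \<gamma> q) q' \<longleftrightarrow> active \<gamma> q' \<and> q' \<noteq> q"
    using q unfolding active_def deactivate_def c by (auto simp: less_Suc_eq)
qed

text \<open>The three exits of \<open>delete_com\<close>: leaf still nonempty, block still nonempty,
  block given up. Naming the outcome separates the invariant from the execution of the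
  program.\<close>

definition cleared :: "(arr \<Rightarrow> nat \<Rightarrow> nat) \<Rightarrow> nat \<Rightarrow> arr \<Rightarrow> nat \<Rightarrow> nat" where
  "cleared \<gamma> j = (let g = j div f; q = g div f; x = leaf \<gamma> g XOR 2 ^ (j mod f);
      \<gamma>1 = \<gamma>(Leaf := (\<gamma> Leaf)(g := x)); s = summ \<gamma> q XOR 2 ^ (g mod f);
      \<gamma>2 = \<gamma>1(Summ := (\<gamma> Summ)(q := s))
    in if x \<noteq> 0 then \<gamma>1 else if s \<noteq> 0 then \<gamma>2 else deactivate \<gamma>2 q)"

lemma valid_delete:
  assumes "valid \<gamma> S" and b: "bit (leaf \<gamma> (j div f)) (j mod f)"
  shows "valid (cleared \<gamma> j) (S - {Suc j})"
proof -
  define g q where "g = j div f" and "q = g div f"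
  define x s where "x = leaf \<gamma> g XOR 2 ^ (j mod f)" and "s = summ \<gamma> q XOR 2 ^ (g mod f)"
  define \<gamma>1 where "\<gamma>1 = \<gamma>(Leaf := (\<gamma> Leaf)(g := x))"
  define \<gamma>2 where "\<gamma>2 = \<gamma>1(Summ := (\<gamma> Summ)(q := s))"
  define \<gamma>' where "\<gamma>' = cleared \<gamma> j"
  have g': "\<gamma>' = (if x \<noteq> 0 then \<gamma>1 else if s \<noteq> 0 then \<gamma>2 else deactivate \<gamma>2 q)"
    by (simp add: \<gamma>'_def cleared_def Let_def g_def q_def x_def s_def \<gamma>1_def \<gamma>2_def)
  note D = validD[OF assms(1)]
  have lq: "bit (summ \<gamma> q) (g mod f)" "active \<gamma> q"
    using leaf_active[OF b] by (simp_all add: g_def q_def)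
  have bx: "bit x i \<longleftrightarrow> bit (leaf \<gamma> g) i \<and> i \<noteq> j mod f" for i
    using b by (auto simp: x_def bit_xor_iff bit_exp_iff g_def)
  have bs: "bit s i \<longleftrightarrow> bit (summ \<gamma> q) i \<and> i \<noteq> g mod f" for i
    using lq(1) by (auto simp: s_def bit_xor_iff bit_exp_iff)
  have a2: "active \<gamma>1 = active \<gamma>" "active \<gamma>2 = active \<gamma>" "sparse \<gamma>1" "sparse \<gamma>2"
    using D(3) by (auto simp: active_def \<gamma>2_def \<gamma>1_def sparse_def fun_eq_iff)
  note dea = deactivate[OF a2(4), of q, unfolded a2(2), OF lq(2)]
  have tab: "knows \<gamma>' = knows \<gamma>"
    by (simp add: fun_eq_iff knows_def g' \<gamma>1_def \<gamma>2_def deactivate_def)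
  have act: "active \<gamma>' q' \<longleftrightarrow> active \<gamma> q' \<and> (q' = q \<longrightarrow> x \<noteq> 0 \<or> s \<noteq> 0)" for q'
    by (auto simp: g' a2 dea)
  have Summ: "\<gamma>' Summ q' = (if q' = q \<and> x = 0 then s else \<gamma> Summ q')"
    and Leaf: "\<gamma>' Leaf g' = (if g' = g then x else \<gamma> Leaf g')" for q' g'
    by (simp_all add: g' \<gamma>1_def \<gamma>2_def deactivate_def)
  have sum: "summ \<gamma>' q' = (if q' = q \<and> x = 0 then s else summ \<gamma> q')" for q'
    unfolding summ_def[of \<gamma>'] act Summ using lq(2) by (simp add: summ_def)
  have ne: "\<not> (g' div f = q \<and> g' mod f = g mod f)" if "g' \<noteq> g" for g'
    using that unfolding q_def using div_mod_eqI by blast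
  have bsum: "bit (summ \<gamma>' (g' div f)) (g' mod f) \<longleftrightarrow>
      bit (summ \<gamma> (g' div f)) (g' mod f) \<and> (g' = g \<longrightarrow> x \<noteq> 0)" for g'
    using ne[of g'] lq(1) by (auto simp: sum bs q_def)
  have lf: "leaf \<gamma>' g' = (if g' = g then x else leaf \<gamma> g')" for g'
    unfolding leaf_def[of \<gamma>'] bsum Leaf using lq(1) by (simp add: leaf_def q_def)
  have g0: "2 ^ (x mod f) < (2::nat) ^ f" for x using mod_f_less[of x] by simp
  have "valid \<gamma>' (S - {Suc j})"
  proof (rule validI)
    show "S - {Suc j} \<subseteq> {1..n}" using D(1) by auto
    have "x < 2 ^ f" "s < 2 ^ f"
      unfolding x_def s_def using g0 summ_leaf_less[OF assms(1)] by (simp_all add: xor_less_exp)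
    then have 2: "\<gamma>2 a i < 2 ^ f" "\<gamma>1 a i < 2 ^ f" for a i using D(2) by (auto simp: \<gamma>2_def \<gamma>1_def)
    have "\<gamma>2 a i - 1 < 2 ^ f" for a i using 2(1)[of a i] by linarith
    with 2 show "\<gamma>' a i < 2 ^ f" for a i by (auto simp: g' deactivate_def)
    show "sparse \<gamma>'" using a2 dea by (simp add: g')
    show "summ \<gamma>' q' \<noteq> 0" if "active \<gamma>' q'" for q'
      using that D(4) unfolding act sum by auto
    show "leaf \<gamma>' g' \<noteq> 0" if "bit (summ \<gamma>' (g' div f)) (g' mod f)" for g'
      using that D(5) unfolding bsum lf by auto
    show "Suc j' \<in> S - {Suc j} \<longleftrightarrow> bit (leaf \<gamma>' (j' div f)) (j' mod f)" for j'
    proof -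
      have "j' = j \<longleftrightarrow> j' div f = g \<and> j' mod f = j mod f" unfolding g_def using div_mod_eqI by blast
      then show ?thesis using D(6)[of j'] by (auto simp: lf bx)
    qed
    show "knows \<gamma>' k'" if "bit (summ \<gamma>' q') k'" for q' k'
      using that D(7) by (auto simp: tab sum bs split: if_splits)
    show "knows \<gamma>' k'" if "bit (leaf \<gamma>' g') k'" for g' k'
      using that D(8) by (auto simp: tab lf bx split: if_splits)
  qed
  then show ?thesis by (simp add: \<gamma>'_def)
qed

end

section \<open>Correctness of the operations\<close>

context layout
begin

lemma Suc_0_less_W [simp]: "Suc 0 < 2 ^ (K * w)"
  using W_gt1 by simp

lemma less_Kw [simp]: "k < f \<Longrightarrow> k < K * w"
  using W_ge by linarith

lemma less_W: "x < 2 ^ f \<Longrightarrow> x < 2 ^ (K * w)" for x :: nat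
  using pow_f_less by linarith

lemma of_bool_less_W [simp]: "of_bool b < (2::nat) ^ (K * w)"
  by (cases b) simp_all

lemma M_less_W: "M < 2 ^ (K * w)"
  using cells_less by (simp add: cells_def)

lemma power2_less: "k < f \<Longrightarrow> (2::nat) ^ k < 2 ^ f"
  by simp

lemma drop_bit_less_W: "x < 2 ^ f \<Longrightarrow> drop_bit k x < 2 ^ (K * w)" for x :: nat
  unfolding drop_bit_eq_div by (rule less_W) (meson div_le_dividend le_less_trans)

lemma test_bit_exp [simp]:
  "mval \<rho> \<gamma> (test_bit_exp a b) = of_bool (bit (mval \<rho> \<gamma> a) (mval \<rho> \<gamma> b))"
  "mval \<rho> \<gamma> a < 2 ^ f \<Longrightarrow> mok \<rho> \<gamma> (test_bit_exp a b) \<longleftrightarrow> mok \<rho> \<gamma> a \<and> mok \<rho> \<gamma> b"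
  by (auto simp: test_bit_exp_def drop_bit_less_W and_one_eq bit_iff_odd_drop_bit mod_2_eq_odd)

lemma power2_exp [simp]:
  "mval \<rho> \<gamma> (power2_exp a) = 2 ^ mval \<rho> \<gamma> a"
  "mval \<rho> \<gamma> a < f \<Longrightarrow> mok \<rho> \<gamma> (power2_exp a) \<longleftrightarrow> mok \<rho> \<gamma> a"
  using less_W[OF power2_less] by (auto simp: power2_exp_def push_bit_eq_mult)

lemma cnt_exp [simp]:
  "mval \<rho> \<gamma> cnt_exp = \<gamma> Cnt 0" "mok \<rho> \<gamma> cnt_exp"
  by (auto simp: cnt_exp_def)

lemma wp_Then [simp]: "wp (Then c d) Q = wp c (wp d Q)"
  by (intro ext) simp

lemma wp_learn:
  assumes "\<rho> v < f"
  shows "wp (learn v) Q \<rho> \<gamma> os \<longleftrightarrow> Q \<rho> (\<gamma>(Tab := (\<gamma> Tab)(2 ^ \<rho> v mod M := \<rho> v))) os"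
  using assms M_gt M_less_W f_less less_trans[OF M_gt(2) M_less_W] less_trans[OF assms f_less]
  by (auto simp: learn_def)

text \<open>Which bit gets isolated is left open, so the table must be right for every set bit, and
  \<open>Q\<close> must hold whichever of them is returned.\<close>

lemma wp_take_low:
  assumes "\<rho> s \<noteq> 0" "\<rho> s < 2 ^ f" "\<And>k. bit (\<rho> s) k \<Longrightarrow> knows \<gamma> k" "s \<noteq> 8" "v \<noteq> 8" "s \<noteq> v"
    and Q: "\<And>k y. bit (\<rho> s) k \<Longrightarrow> (\<And>i. bit y i \<longleftrightarrow> bit (\<rho> s) i \<and> i \<noteq> k) \<Longrightarrow>
      Q (\<rho>(8 := y, v := k, s := y)) \<gamma> os"
  shows "wp (take_low s v) Q \<rho> \<gamma> os"
proof -
  define x y where "x = \<rho> s" and "y = x AND (x - 1)"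
  obtain k where k: "bit x k" "\<And>i. bit y i \<longleftrightarrow> bit x i \<and> i \<noteq> k"
    using clear_lowest_bit[of x] assms(1) unfolding x_def y_def by blast
  have eq: "x XOR y = 2 ^ k"
    by (rule bit_eqI) (use k in \<open>auto simp: bit_xor_iff bit_exp_iff\<close>)
  have "y < 2 ^ (K * w)" unfolding y_def by (intro less_W and_less_exp) (use assms(2) x_def in simp)
  moreover have "x - 1 < 2 ^ (K * w)" "x XOR y < 2 ^ (K * w)"
    using assms(2) less_W[OF and_less_exp[of x f "x - 1"]] less_W[of x] bit_less_exp[OF assms(2), of k] k(1)
    unfolding eq by (auto simp: x_def intro: less_W power2_less)
  moreover have "\<gamma> Tab ((x XOR y) mod M) = k" "(x XOR y) mod M < 2 ^ (K * w)"
    using assms(3)[of k] k(1) less_trans[OF M_gt(2) M_less_W] unfolding eq by (auto simp: knows_def x_def)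
  moreover have "1 \<le> x" using assms(1) by (simp add: x_def)
  ultimately show ?thesis
    using Q[OF k(1)[unfolded x_def] k(2)[unfolded x_def]] assms(4-6) M_gt
    by (simp add: take_low_def x_def[symmetric] y_def[symmetric] del: One_nat_def)
qed

lemma index_facts:
  assumes "j < n"
  shows "j < 2 ^ f" "j div f < N * f" "j div f div f < N" "j div f < 2 ^ f" "j div f div f < 2 ^ f"
    "j mod f < 2 ^ f" "j div f mod f < 2 ^ f"
proof -
  show 1: "j < 2 ^ f" using assms n_less by linarith
  show "j div f < N * f" "j div f div f < N" using cover[OF assms] by auto
  show "j div f < 2 ^ f" "j div f div f < 2 ^ f"
    using 1 div_le_dividend le_less_trans by metis+
  show "j mod f < 2 ^ f" "j div f mod f < 2 ^ f"
    using mod_f_less f_less less_trans by metis+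
qed

lemma wp_locate:
  assumes v: "valid \<gamma> S" and "\<rho> 0 = Suc j" "j < n"
    and Q: "\<And>\<rho>'. \<rho>' 9 = j mod f \<Longrightarrow> \<rho>' 2 = j div f \<Longrightarrow> \<rho>' 3 = j div f mod f \<Longrightarrow>
      \<rho>' 4 = j div f div f \<Longrightarrow> \<rho>' 5 = \<gamma> Pos (j div f div f) \<Longrightarrow> \<rho>' 6 = summ \<gamma> (j div f div f) \<Longrightarrow>
      \<rho>' 7 = leaf \<gamma> (j div f) \<Longrightarrow> Q \<rho>' \<gamma> os"
  shows "wp locate Q \<rho> \<gamma> os"
proof -
  define g where "g = j div f"
  define q where "q = g div f"
  note I = index_facts[OF assms(3), folded g_def, folded q_def]
  note D = validD[OF v]
  have cN: "\<gamma> Cnt 0 \<le> N" using D(3) by (simp add: sparse_def)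
  have q: "summ \<gamma> q = (if \<gamma> Pos q < \<gamma> Cnt 0 \<and> \<gamma> Lst (\<gamma> Pos q) = q then \<gamma> Summ q else 0)"
    by (simp add: summ_def active_def)
  have lf: "leaf \<gamma> g = (if bit (summ \<gamma> q) (g mod f) then \<gamma> Leaf g else 0)"
    by (simp add: leaf_def q_def)
  note Q' = Q[folded g_def, folded q_def]
  show ?thesis
    unfolding locate_def wp.simps
    using I cN D(2) less_W[OF I(1)] less_W[OF I(4)] less_W[OF I(5)] less_W[OF I(6)] less_W[OF I(7)] assms(2)
    by (auto intro!: Q' simp: g_def[symmetric] q_def[symmetric] q lf)
qed

lemma wp_insert:
  assumes v: "valid \<gamma> S" and "\<rho> 0 = Suc j" "j < n"
  shows "wp insert_com (\<lambda>\<rho> \<gamma> os. valid \<gamma> (S \<union> {Suc j})) \<rho> \<gamma> os"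
  unfolding insert_com_def wp_Then
proof (rule wp_locate[where \<rho> = \<rho> and j = j, OF assms])
  fix \<rho>
  define k g where "k = j mod f" and "g = j div f"
  define l q where "l = g mod f" and "q = g div f"
  assume \<rho>: "\<rho> (9::nat) = j mod f" "\<rho> 2 = j div f" "\<rho> 3 = j div f mod f" "\<rho> 4 = j div f div f"
    "\<rho> 5 = \<gamma> Pos (j div f div f)" "\<rho> 6 = summ \<gamma> (j div f div f)" "\<rho> 7 = leaf \<gamma> (j div f)"
  note \<rho>' = \<rho>[folded g_def k_def, folded q_def l_def]
  note I = index_facts[OF assms(3), folded g_def k_def, folded q_def l_def]
  have kl: "k < f" "l < f" using f_pos by (simp_all add: k_def l_def)
  define \<gamma>1 where "\<gamma>1 = \<gamma>(Tab := (\<gamma> Tab)(2 ^ k mod M := k))"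
  define \<gamma>2 where "\<gamma>2 = \<gamma>1(Tab := (\<gamma>1 Tab)(2 ^ l mod M := l))"
  note L1 = valid_learn[OF v kl(1), folded \<gamma>1_def]
  note L2 = valid_learn[OF L1(1) kl(2), folded \<gamma>2_def]
  note D = validD[OF L2(1)]
  define \<gamma>3 where "\<gamma>3 = (activate \<gamma>2 q)(Summ := (\<gamma>2 Summ)(q := summ \<gamma>2 q OR 2 ^ l),
    Leaf := (\<gamma>2 Leaf)(g := leaf \<gamma>2 g OR 2 ^ k))"
  \<comment> \<open>The second \<open>learn\<close> keeps what the first one recorded.\<close>
  have v3: "valid \<gamma>3 (S \<union> {Suc j})"
    using valid_insert[OF L2(1) assms(3)] L2(2) L2(3)[OF kl(1) L1(2)]
    by (simp add: \<gamma>3_def g_def k_def l_def q_def)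
  have b: "summ \<gamma>2 q OR 2 ^ l < 2 ^ f" "leaf \<gamma>2 g OR 2 ^ k < 2 ^ f"
    using summ_leaf_less[OF L2(1)] kl by (simp_all add: or_less_exp)
  \<comment> \<open>Active blocks have nonempty summaries; this is why testing variable 6 suffices
    to decide whether the block must be added to the list.\<close>
  have a: "summ \<gamma>2 q = 0 \<longleftrightarrow> \<not> active \<gamma>2 q" using D(4)[of q] by (auto simp: summ_def)
  have c: "\<gamma>2 Cnt 0 < N" "\<gamma>2 Cnt 0 + 1 < 2 ^ f" if "\<not> active \<gamma>2 q"
    using cnt_less[OF D(3) that I(3)] N_less by simp_all
  have cw: "Suc (\<gamma>2 Cnt 0) < 2 ^ (K * w)" if "\<not> active \<gamma>2 q" using less_W[OF c(2)[OF that]] by simp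
  show "wp (learn 9) (wp (learn 3) (wp (Cond (Var 6) Nop (Then (Put Lst cnt_exp (Var 4))
      (Then (Put Pos (Var 4) cnt_exp) (Put Cnt (Num 0) (Bin Add cnt_exp (Num 1))))))
      (wp (Put Summ (Var 4) (Bin Disj (Var 6) (power2_exp (Var 3))))
      (wp (Put Leaf (Var 2) (Bin Disj (Var 7) (power2_exp (Var 9)))) (\<lambda>\<rho> \<gamma> os. valid \<gamma> (S \<union> {Suc j}))))))
      \<rho> \<gamma> os"
  proof (cases "active \<gamma>2 q")
    case True
    then show ?thesis
      using v3 kl I b less_W[OF b(1)] less_W[OF b(2)] a
      by (simp add: wp_learn \<rho>' L1(4-6) L2(4-6) \<gamma>1_def[symmetric] \<gamma>2_def[symmetric] \<gamma>3_def activate_def)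
  next
    case False
    then show ?thesis
      using v3 kl I b less_W[OF b(1)] less_W[OF b(2)] a c cw D(2)
      by (simp add: wp_learn \<rho>' L1(4-6) L2(4-6) \<gamma>1_def[symmetric] \<gamma>2_def[symmetric] \<gamma>3_def activate_def)
  qed
qed

lemma wp_delete:
  assumes v: "valid \<gamma> S" and "\<rho> 0 = Suc j" "j < n"
  shows "wp delete_com (\<lambda>\<rho> \<gamma> os. valid \<gamma> (S - {Suc j})) \<rho> \<gamma> os"
  unfolding delete_com_def wp.simps(5)
proof (rule wp_locate[where \<rho> = \<rho> and j = j, OF assms])
  fix \<rho>
  define k g where "k = j mod f" and "g = j div f"
  define l q where "l = g mod f" and "q = g div f"
  assume \<rho>: "\<rho> (9::nat) = j mod f" "\<rho> 2 = j div f" "\<rho> 3 = j div f mod f" "\<rho> 4 = j div f div f"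
    "\<rho> 5 = \<gamma> Pos (j div f div f)" "\<rho> 6 = summ \<gamma> (j div f div f)" "\<rho> 7 = leaf \<gamma> (j div f)"
  note \<rho>' = \<rho>[folded g_def k_def, folded q_def l_def]
  note I = index_facts[OF assms(3), folded g_def k_def, folded q_def l_def]
  have kl: "k < f" "l < f" using f_pos by (simp_all add: k_def l_def)
  note D = validD[OF v]
  note SL = summ_leaf_less[OF v]
  define x s where "x = leaf \<gamma> g XOR 2 ^ k" and "s = summ \<gamma> q XOR 2 ^ l"
  have b: "x < 2 ^ f" "s < 2 ^ f"
    unfolding x_def s_def using SL kl by (simp_all add: xor_less_exp)
  have iff: "Suc j \<in> S \<longleftrightarrow> bit (leaf \<gamma> g) k" using D(6) by (simp add: g_def k_def)
  show "wp (Cond (test_bit_exp (Var 7) (Var 9))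
     (Then (Asg 7 (Bin Xor (Var 7) (power2_exp (Var 9))))
     (Then (Put Leaf (Var 2) (Var 7))
     (Cond (Var 7) Nop
       (Then (Asg 6 (Bin Xor (Var 6) (power2_exp (Var 3))))
       (Then (Put Summ (Var 4) (Var 6))
       (Cond (Var 6) Nop
         (Then (Put Cnt (Num 0) (Bin Sub cnt_exp (Num 1)))
         (Then (Asg 8 (Cell Lst cnt_exp))
         (Then (Put Lst (Var 5) (Var 8)) (Put Pos (Var 8) (Var 5)))))))))))
     Nop) (\<lambda>\<rho> \<gamma> os. valid \<gamma> (S - {Suc j})) \<rho> \<gamma> os"
  proof (cases "bit (leaf \<gamma> g) k")
    case False
    then show ?thesis using v iff SL by (simp add: \<rho>')
  next
    case True
    have aq: "active \<gamma> q" using leaf_active(2)[OF True] by (simp add: q_def)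
    define c where "c = \<gamma> Cnt 0 - 1"
    have c: "\<gamma> Cnt 0 = Suc c" "c < N" "\<gamma> Pos q < N"
      using aq D(3) by (auto simp: c_def active_def sparse_def)
    have lst: "\<gamma> Lst c < N" using sparseD(1)[OF D(3), of c] c by simp
    define \<gamma>1 \<gamma>2 where "\<gamma>1 = \<gamma>(Leaf := (\<gamma> Leaf)(g := x))"
      and "\<gamma>2 = \<gamma>1(Summ := (\<gamma>1 Summ)(q := s))"
    have eq: "cleared \<gamma> j = (if x \<noteq> 0 then \<gamma>1 else if s \<noteq> 0 then \<gamma>2 else deactivate \<gamma>2 q)"
      by (simp add: cleared_def Let_def x_def s_def g_def q_def k_def l_def \<gamma>1_def \<gamma>2_def)
    note v = valid_delete[OF v True[unfolded g_def k_def], unfolded eq]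
    have v': "x \<noteq> 0 \<Longrightarrow> valid \<gamma>1 (S - {Suc j})" "x = 0 \<Longrightarrow> s \<noteq> 0 \<Longrightarrow> valid \<gamma>2 (S - {Suc j})"
      "x = 0 \<Longrightarrow> s = 0 \<Longrightarrow> valid (deactivate \<gamma>2 q) (S - {Suc j})"
      using v by simp_all
    have cw: "c < 2 ^ f" using c(2) N_less by simp
    show ?thesis
      using v' True SL kl I less_W[OF b(1)] less_W[OF b(2)] b c lst D(2) cw less_W[OF cw]
      by (simp add: \<rho>' x_def[symmetric] s_def[symmetric] \<gamma>1_def \<gamma>2_def deactivate_def)
  qed
qed

lemma wp_search:
  assumes v: "valid \<gamma> S" and "\<rho> 0 = Suc j" "j < n"
  shows "wp search_com (\<lambda>\<rho> \<gamma> os. valid \<gamma> S \<and> \<rho> 0 = of_bool (Suc j \<in> S)) \<rho> \<gamma> os"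
  unfolding search_com_def wp_Then
  by (rule wp_locate[where \<rho> = \<rho> and j = j, OF assms]) (use v summ_leaf_less[OF v] validD(6)[OF v, of j] in simp)

text \<open>Variable 6 may be any nonempty part of the summary: \<open>findany\<close> supplies all
  of it, enumeration the leaves not yet visited.\<close>

lemma wp_next_leaf:
  assumes v: "valid \<gamma> S" and a: "active \<gamma> (\<rho> 4)" and s: "\<rho> 6 \<noteq> 0" "\<And>l. bit (\<rho> 6) l \<Longrightarrow> bit (summ \<gamma> (\<rho> 4)) l"
    and Q: "\<And>l y. bit (\<rho> 6) l \<Longrightarrow> l < f \<Longrightarrow> (\<And>i. bit y i \<longleftrightarrow> bit (\<rho> 6) i \<and> i \<noteq> l) \<Longrightarrow>
      Q (\<rho>(8 := y, 3 := l, 6 := y, 2 := \<rho> 4 * f + l, 7 := leaf \<gamma> (\<rho> 4 * f + l))) \<gamma> os"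
  shows "wp next_leaf Q \<rho> \<gamma> os"
  unfolding next_leaf_def wp_Then
proof (rule wp_take_low)
  note D = validD[OF v]
  have bf: "l < f" if "bit (\<rho> 6) l" for l
    using s(2)[OF that] bit_less_exp summ_leaf_less(1)[OF v] by blast
  have "take_bit f (\<rho> 6) = \<rho> 6"
    by (rule bit_eqI) (use bf in \<open>auto simp: bit_take_bit_iff\<close>)
  then show "\<rho> 6 < 2 ^ f" by (metis take_bit_nat_less_exp)
  show "knows \<gamma> k" if "bit (\<rho> 6) k" for k using D(7) s(2)[OF that] by blast
  fix k y :: nat assume k: "bit (\<rho> 6) k" and y: "\<And>i. bit y i \<longleftrightarrow> bit (\<rho> 6) i \<and> i \<noteq> k"
  note kf = bf[OF k]
  have q: "\<rho> 4 < N" using active_less[OF D(3) a] .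
  have lt: "\<rho> 4 * f + k < N * f"
  proof -
    have "\<rho> 4 * f + k < (\<rho> 4 + 1) * f" using kf by simp
    also have "\<dots> \<le> N * f" using q by (intro mult_le_mono1) simp
    finally show ?thesis .
  qed
  have "N * f \<le> cells" by (simp add: cells_def)
  then have "\<rho> 4 * f + k < 2 ^ (K * w)" "\<rho> 4 * f < 2 ^ (K * w)" using lt cells_less by linarith+
  moreover have "leaf \<gamma> (\<rho> 4 * f + k) = \<gamma> Leaf (\<rho> 4 * f + k)"
    using s(2)[OF k] div_mod_f[OF kf] by (simp add: leaf_def)
  ultimately show "wp (Asg 2 (Bin Add (Bin Mul (Var 4) Width) (Var 3)))
      (wp (Asg 7 (Cell Leaf (Var 2))) Q) (\<rho>(8 := y, 3 := k, 6 := y)) \<gamma> os"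
    using Q[OF k kf y] lt by simp
qed (use s in simp_all)

lemma elem_exp:
  assumes v: "valid \<gamma> S" and "bit (leaf \<gamma> (\<rho> 2)) (\<rho> 9)"
  shows "mok \<rho> \<gamma> elem_exp" "mval \<rho> \<gamma> elem_exp = Suc (\<rho> 2 * f + \<rho> 9)" "Suc (\<rho> 2 * f + \<rho> 9) \<in> S"
proof -
  have "\<rho> 9 < f" using bit_less_exp[OF summ_leaf_less(2)[OF v] assms(2)] .
  then show 1: "Suc (\<rho> 2 * f + \<rho> 9) \<in> S"
    using assms(2) div_mod_f validD(6)[OF v] by simp
  then have "Suc (\<rho> 2 * f + \<rho> 9) \<le> n" using validD(1)[OF v] by auto
  then have "Suc (\<rho> 2 * f + \<rho> 9) < 2 ^ (K * w)" using n_less pow_f_less by linarith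
  then show "mok \<rho> \<gamma> elem_exp" by (simp add: elem_exp_def)
  show "mval \<rho> \<gamma> elem_exp = Suc (\<rho> 2 * f + \<rho> 9)" by (simp add: elem_exp_def)
qed

lemma wp_findany:
  assumes v: "valid \<gamma> S"
  shows "wp findany_com (\<lambda>\<rho> \<gamma> os. valid \<gamma> S \<and> (if S = {} then \<rho> 0 = 0 else \<rho> 0 \<in> S)) \<rho> \<gamma> os"
proof (cases "\<gamma> Cnt 0 = 0")
  case True
  \<comment> \<open>An element would lie in an active block, whose back pointer is below the
    count.\<close>
  have "i \<notin> S" for i
  proof
    assume i: "i \<in> S"
    then obtain j where "i = Suc j" using validD(1)[OF v] by (cases i) auto
    then show False using i validD(6)[OF v, of j] leaf_active(2)[of \<gamma> "j div f" "j mod f"] True by (auto simp: active_def)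
  qed
  then have "S = {}" by blast
  then show ?thesis using v True by (simp add: findany_com_def)
next
  case False
  note D = validD[OF v]
  define q where "q = \<gamma> Lst 0"
  have a: "active \<gamma> q" using active_Lst[OF D(3)] False by (simp add: q_def)
  have q: "q < N" using active_less[OF D(3) a] .
  have s: "\<gamma> Summ q = summ \<gamma> q" using a by (simp add: summ_def)
  have "wp next_leaf (wp (take_low 7 9) (wp (Asg 0 elem_exp)
      (\<lambda>\<rho> \<gamma> os. valid \<gamma> S \<and> (if S = {} then \<rho> 0 = 0 else \<rho> 0 \<in> S)))) (\<rho>(4 := q, 6 := summ \<gamma> q)) \<gamma> os"
    (is "wp next_leaf ?Q ?\<rho> \<gamma> os")
  proof (rule wp_next_leaf[OF v])
    show "active \<gamma> (?\<rho> 4)" "?\<rho> 6 \<noteq> 0" using a D(4) by simp_all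
    fix l y assume l: "bit (?\<rho> 6) l" "l < f"
    define g where "g = q * f + l"
    \<comment> \<open>A set summary bit promises a nonempty leaf, so the first leaf tried yields an
      element.\<close>
    have g: "leaf \<gamma> g \<noteq> 0" using D(5)[of g] l div_mod_f[OF l(2)] by (simp add: g_def)
    let ?\<rho>1 = "?\<rho>(8 := y, 3 := l, 6 := y, 2 := ?\<rho> 4 * f + l, 7 := leaf \<gamma> (?\<rho> 4 * f + l))"
    show "?Q ?\<rho>1 \<gamma> os"
    proof (rule wp_take_low)
      show "?\<rho>1 7 \<noteq> 0" "?\<rho>1 7 < 2 ^ f" "\<And>k. bit (?\<rho>1 7) k \<Longrightarrow> knows \<gamma> k"
        using g summ_leaf_less(2)[OF v] D(8) by (simp_all add: g_def)
      fix k z assume b: "bit (?\<rho>1 7) k"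
      define \<rho>2 where "\<rho>2 = ?\<rho>1(8 := z, 9 := k, 7 := z)"
      have "bit (leaf \<gamma> (\<rho>2 2)) (\<rho>2 9)" using b by (simp add: \<rho>2_def)
      from elem_exp[OF v this]
      show "wp (Asg 0 elem_exp) (\<lambda>\<rho> \<gamma> os. valid \<gamma> S \<and> (if S = {} then \<rho> 0 = 0 else \<rho> 0 \<in> S))
          (?\<rho>1(8 := z, 9 := k, 7 := z)) \<gamma> os"
        unfolding \<rho>2_def[symmetric] using v by auto
    qed simp_all
  qed simp
  then show ?thesis
    using False N_pos q s by (simp add: findany_com_def q_def[symmetric])
qed

text \<open>With count 0 no block is active, so all summaries and leaves read as 0 whatever the
  memory holds; the size bound on raw cells holds for any contents.\<close>

lemma wp_init: "wp init_com (\<lambda>\<rho> \<gamma> os. valid \<gamma> {}) \<rho> (contents m) os"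
  by (auto simp: init_com_def valid_def sparse_def active_def summ_def leaf_def contents_less)

end

section \<open>Enumeration\<close>

text \<open>Adapts the calling convention: \<open>f\<close> is computed into register 4, and
  variable 0 (register 7) exchanges argument and result with register 0.\<close>

definition program :: "com \<Rightarrow> com" where
  "program c = Seq (Assign 4 (Op Add (Reg 2) (Const 1)))
     (Seq (Assign 7 (Reg 0)) (Seq c (Assign 0 (Reg 7))))"

definition programs :: "nat \<Rightarrow> set_programs" where
  "programs h =
     \<lparr>init_prog = program (compile h init_com),
      insert_prog = program (compile h insert_com),
      delete_prog = program (compile h delete_com),
      search_prog = program (compile h search_com),
      findany_prog = program (compile h findany_com),
      enum_prog = program (Seq (compile h start_com) (While (compile_exp h pending_exp) (compile h emit_com)))\<rparr>"

text \<open>A sum serves as a common bound for all operations. The 9 consists of 8 units for the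
  frame \<open>program\<close> and 1 for the test of the loop.\<close>

definition time_bound :: "nat \<Rightarrow> nat" where
  "time_bound h = 9 + max_time (compile h init_com) + max_time (compile h insert_com) +
     max_time (compile h delete_com) + max_time (compile h search_com) + max_time (compile h findany_com) +
     max_time (compile h start_com) + cost (compile_exp h pending_exp) + max_time (compile h emit_com)"

lemma bit_nonzero: "bit x k \<Longrightarrow> x \<noteq> 0" for x :: nat
  by (rule notI) simp

context layout
begin

text \<open>
  Still to be output are the bits \<open>x\<close> of leaf \<open>g\<close>, the leaves \<open>s\<close> of block \<open>q\<close>, and the blocks at
  positions from \<open>p\<close> on.
\<close>

definition cursor ::
  "(arr \<Rightarrow> nat \<Rightarrow> nat) \<Rightarrow> nat set \<Rightarrow> nat list \<Rightarrow> nat \<Rightarrow> nat \<Rightarrow> nat \<Rightarrow> nat \<Rightarrow> nat \<Rightarrow> bool" where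
  "cursor \<gamma> S os p q s g x \<longleftrightarrow> distinct os \<and> set os \<subseteq> S \<and> p \<le> \<gamma> Cnt 0 \<and>
     (s \<noteq> 0 \<longrightarrow> active \<gamma> q \<and> \<gamma> Pos q < p) \<and> (\<forall>l. bit s l \<longrightarrow> bit (summ \<gamma> q) l) \<and>
     (x \<noteq> 0 \<longrightarrow> \<gamma> Pos (g div f) < p \<and> \<not> (q = g div f \<and> bit s (g mod f))) \<and>
     (\<forall>k. bit x k \<longrightarrow> bit (leaf \<gamma> g) k) \<and>
     (\<forall>j. Suc j \<in> S \<longrightarrow> (Suc j \<notin> set os \<longleftrightarrow> p \<le> \<gamma> Pos (j div f div f) \<or>
       (j div f div f = q \<and> bit s (j div f mod f)) \<or> (j div f = g \<and> bit x (j mod f))))"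

lemma cursorI:
  assumes "distinct os" "set os \<subseteq> S" "p \<le> \<gamma> Cnt 0" "s \<noteq> 0 \<Longrightarrow> active \<gamma> q \<and> \<gamma> Pos q < p"
    "\<And>l. bit s l \<Longrightarrow> bit (summ \<gamma> q) l"
    "x \<noteq> 0 \<Longrightarrow> \<gamma> Pos (g div f) < p \<and> \<not> (q = g div f \<and> bit s (g mod f))"
    "\<And>k. bit x k \<Longrightarrow> bit (leaf \<gamma> g) k"
    "\<And>j. Suc j \<in> S \<Longrightarrow> Suc j \<notin> set os \<longleftrightarrow> p \<le> \<gamma> Pos (j div f div f) \<or>
       (j div f div f = q \<and> bit s (j div f mod f)) \<or> (j div f = g \<and> bit x (j mod f))"
  shows "cursor \<gamma> S os p q s g x"
  using assms unfolding cursor_def by blast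

lemma cursorD:
  assumes "cursor \<gamma> S os p q s g x"
  shows "distinct os" "set os \<subseteq> S" "p \<le> \<gamma> Cnt 0" "s \<noteq> 0 \<Longrightarrow> active \<gamma> q \<and> \<gamma> Pos q < p"
    "bit s l \<Longrightarrow> bit (summ \<gamma> q) l"
    "x \<noteq> 0 \<Longrightarrow> \<gamma> Pos (g div f) < p" "x \<noteq> 0 \<Longrightarrow> q = g div f \<Longrightarrow> \<not> bit s (g mod f)"
    "bit x k \<Longrightarrow> bit (leaf \<gamma> g) k"
    "Suc j \<in> S \<Longrightarrow> Suc j \<notin> set os \<longleftrightarrow> p \<le> \<gamma> Pos (j div f div f) \<or>
       (j div f div f = q \<and> bit s (j div f mod f)) \<or> (j div f = g \<and> bit x (j mod f))"
  using assms unfolding cursor_def by blast+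

lemma mem_valid:
  assumes "valid \<gamma> S" "Suc j \<in> S"
  shows "active \<gamma> (j div f div f)" "bit (summ \<gamma> (j div f div f)) (j div f mod f)"
    "bit (leaf \<gamma> (j div f)) (j mod f)"
proof -
  show b: "bit (leaf \<gamma> (j div f)) (j mod f)" using assms validD(6) by blast
  show "active \<gamma> (j div f div f)" "bit (summ \<gamma> (j div f div f)) (j div f mod f)"
    using leaf_active[OF b] by blast+
qed

lemma cursor_start:
  assumes "valid \<gamma> S"
  shows "cursor \<gamma> S [] 0 q 0 g 0"
  by (rule cursorI) auto

lemma cursor_done:
  assumes v: "valid \<gamma> S" and c: "cursor \<gamma> S os p q 0 g 0" and p: "\<not> p < \<gamma> Cnt 0"
  shows "distinct os" "set os = S"
proof -
  note C = cursorD[OF c]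
  have "i \<in> set os" if i: "i \<in> S" for i
  proof -
    obtain j where j: "i = Suc j" using validD(1)[OF v] i by (cases i) auto
    have "\<gamma> Pos (j div f div f) < p" using mem_valid(1)[OF v i[unfolded j]] p by (simp add: active_def)
    then show ?thesis using C(9)[of j] i j by auto
  qed
  then show "distinct os" "set os = S" using C(1,2) by auto
qed

text \<open>The elements of the block at position \<open>p\<close> pass from the first disjunct of
  being pending to the second: for active blocks, having position \<open>p\<close> and being
  \<open>\<gamma> Lst p\<close> coincide.\<close>

lemma cursor_block:
  assumes v: "valid \<gamma> S" and c: "cursor \<gamma> S os p q 0 g 0" and p: "p < \<gamma> Cnt 0"
  shows "cursor \<gamma> S os (Suc p) (\<gamma> Lst p) (summ \<gamma> (\<gamma> Lst p)) g 0"
proof -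
  note C = cursorD[OF c] and sp = validD(3)[OF v]
  note L = sparseD(2)[OF sp p]
  show ?thesis
  proof (rule cursorI)
    fix j assume j: "Suc j \<in> S"
    note m = mem_valid[OF v j]
    have "\<gamma> Pos (j div f div f) = p \<longleftrightarrow> j div f div f = \<gamma> Lst p"
      using m(1) L by (auto simp: active_def)
    then show "Suc j \<notin> set os \<longleftrightarrow> Suc p \<le> \<gamma> Pos (j div f div f) \<or>
       (j div f div f = \<gamma> Lst p \<and> bit (summ \<gamma> (\<gamma> Lst p)) (j div f mod f)) \<or>
       (j div f = g \<and> bit (0::nat) (j mod f))"
      using C(9)[OF j] m(2) by (auto simp: le_less Suc_le_eq)
  qed (use C p L active_Lst[OF sp p] in auto)
qed

text \<open>The elements of the chosen leaf pass from the second disjunct to the third, which is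
  vacant as the previous leaf is exhausted.\<close>

lemma cursor_leaf:
  assumes v: "valid \<gamma> S" and c: "cursor \<gamma> S os p q s g 0" and l: "bit s l" "l < f"
    and s': "\<And>i. bit s' i \<longleftrightarrow> bit s i \<and> i \<noteq> l"
  shows "cursor \<gamma> S os p q s' (q * f + l) (leaf \<gamma> (q * f + l))"
proof -
  note C = cursorD[OF c]
  have s0: "s \<noteq> 0" using l(1) by (rule bit_nonzero)
  note dm = div_mod_f[OF l(2), of q]
  show ?thesis
  proof (rule cursorI)
    fix j assume j: "Suc j \<in> S"
    note m = mem_valid[OF v j]
    have eq: "j div f = q * f + l \<longleftrightarrow> j div f div f = q \<and> j div f mod f = l"
      by (rule div_mod_f_iff[OF l(2)])
    show "Suc j \<notin> set os \<longleftrightarrow> p \<le> \<gamma> Pos (j div f div f) \<or>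
       (j div f div f = q \<and> bit s' (j div f mod f)) \<or>
       (j div f = q * f + l \<and> bit (leaf \<gamma> (q * f + l)) (j mod f))"
    proof (cases "j div f = q * f + l")
      case True
      then show ?thesis using C(9)[OF j] m(3) l(1) eq by auto
    next
      case False
      then show ?thesis using C(9)[OF j] eq s' by auto
    qed
  qed (use C s0 s' dm in auto)
qed

text \<open>The emitted element must not remain pending by another disjunct; the clause of
  \<open>cursor\<close> for \<open>x \<noteq> 0\<close> says that its block has been passed and its
  leaf already struck from \<open>s\<close>.\<close>

lemma cursor_emit:
  assumes v: "valid \<gamma> S" and c: "cursor \<gamma> S os p q s g x" and k: "bit x k"
    and x': "\<And>i. bit x' i \<longleftrightarrow> bit x i \<and> i \<noteq> k"
  shows "cursor \<gamma> S (os @ [Suc (g * f + k)]) p q s g x'"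
proof -
  note C = cursorD[OF c]
  have x0: "x \<noteq> 0" using k by (rule bit_nonzero)
  have kf: "k < f" using C(8)[OF k] bit_less_exp[OF summ_leaf_less(2)[OF v]] by blast
  define j where "j = g * f + k"
  have d: "j div f = g" "j mod f = k" using div_mod_f[OF kf] by (simp_all add: j_def)
  have j: "Suc j \<in> S" using validD(6)[OF v, of j] C(8)[OF k] d by simp
  have new: "Suc j \<notin> set os" using C(9)[OF j] k d by simp
  have "cursor \<gamma> S (os @ [Suc j]) p q s g x'"
  proof (rule cursorI)
    fix i assume i: "Suc i \<in> S"
    have eq: "i = j \<longleftrightarrow> i div f = g \<and> i mod f = k" using d div_mod_eqI by blast
    show "Suc i \<notin> set (os @ [Suc j]) \<longleftrightarrow> p \<le> \<gamma> Pos (i div f div f) \<or>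
       (i div f div f = q \<and> bit s (i div f mod f)) \<or> (i div f = g \<and> bit x' (i mod f))"
    proof (cases "i = j")
      case True
      then show ?thesis using C(6)[OF x0] C(7)[OF x0] x' d by auto
    next
      case False
      then show ?thesis using C(9)[OF i] x' eq by auto
    qed
  qed (use C x0 x' new j in auto)
  then show ?thesis by (simp add: j_def)
qed

lemma subbits_less:
  assumes "\<And>i. bit s i \<Longrightarrow> bit t i" "t < (2::nat) ^ f"
  shows "s < (2::nat) ^ f"
proof -
  have "take_bit f s = s"
    by (rule bit_eqI) (use assms bit_less_exp in \<open>auto simp: bit_take_bit_iff\<close>)
  then show ?thesis by (metis take_bit_nat_less_exp)
qed

lemma cursor_less:
  assumes v: "valid \<gamma> S" and c: "cursor \<gamma> S os p q s g x"
  shows "s < 2 ^ f" "x < 2 ^ f"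
  using subbits_less[OF cursorD(5)[OF c] summ_leaf_less(1)[OF v]]
    subbits_less[OF cursorD(8)[OF c] summ_leaf_less(2)[OF v]] by blast+

text \<open>Enumeration only reads, so the contents stay equal to one fixed
  \<open>\<gamma>\<close>.\<close>

definition cursor_state where
  "cursor_state \<gamma> S \<rho> \<gamma>' os \<longleftrightarrow> \<gamma>' = \<gamma> \<and> cursor \<gamma> S os (\<rho> 5) (\<rho> 4) (\<rho> 6) (\<rho> 2) (\<rho> 7)"

lemma pending_exp:
  assumes v: "valid \<gamma> S" and c: "cursor_state \<gamma> S \<rho> \<gamma>' os"
  shows "mok \<rho> \<gamma>' pending_exp"
    "mval \<rho> \<gamma>' pending_exp \<noteq> 0 \<longleftrightarrow> \<rho> 5 < \<gamma> Cnt 0 \<or> \<rho> 6 \<noteq> 0 \<or> \<rho> 7 \<noteq> 0"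
proof -
  have "\<rho> 6 < 2 ^ f" "\<rho> 7 < 2 ^ f" using cursor_less[OF v] c by (auto simp: cursor_state_def)
  then have a: "\<rho> 6 OR \<rho> 7 < 2 ^ f" by (rule or_less_exp)
  have b: "of_bool P < (2::nat) ^ f" for P
    using power_increasing[of 1 f "2::nat"] f_pos by (cases P) auto
  show "mok \<rho> \<gamma>' pending_exp"
    using less_W[OF a] less_W[OF or_less_exp[OF b a]] by (simp add: pending_exp_def)
  show "mval \<rho> \<gamma>' pending_exp \<noteq> 0 \<longleftrightarrow> \<rho> 5 < \<gamma> Cnt 0 \<or> \<rho> 6 \<noteq> 0 \<or> \<rho> 7 \<noteq> 0"
    using c by (auto simp: pending_exp_def cursor_state_def or_eq_0_iff)
qed

text \<open>Progress in each iteration: a block taken from the list has a nonempty summary and a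
  leaf taken from a summary is nonempty, so the output step is always reached with a bit at
  hand.\<close>

lemma wp_emit:
  assumes v: "valid \<gamma> S" and c: "cursor_state \<gamma> S \<rho> \<gamma> os"
    and nz: "\<rho> 5 < \<gamma> Cnt 0 \<or> \<rho> 6 \<noteq> 0 \<or> \<rho> 7 \<noteq> 0"
  shows "wp emit_com (\<lambda>\<rho> \<gamma>' os'. cursor_state \<gamma> S \<rho> \<gamma>' os' \<and> length os < length os') \<rho> \<gamma> os"
proof -
  let ?Q = "\<lambda>\<rho> \<gamma>' os'. cursor_state \<gamma> S \<rho> \<gamma>' os' \<and> length os < length os'"
  let ?R = "wp (take_low 7 9) (wp (Out elem_exp) ?Q)"
  note D = validD[OF v]
  have out: "?R \<rho> \<gamma> os" if c: "cursor_state \<gamma> S \<rho> \<gamma> os" and "\<rho> 7 \<noteq> 0" for \<rho>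
  proof (rule wp_take_low)
    have cu: "cursor \<gamma> S os (\<rho> 5) (\<rho> 4) (\<rho> 6) (\<rho> 2) (\<rho> 7)" using c by (simp add: cursor_state_def)
    show "\<rho> 7 < 2 ^ f" using cursor_less(2)[OF v cu] .
    show "knows \<gamma> k" if "bit (\<rho> 7) k" for k using D(8) cursorD(8)[OF cu that] by blast
    fix k and y :: nat
    assume k: "bit (\<rho> 7) k" and y: "\<And>i. bit y i \<longleftrightarrow> bit (\<rho> 7) i \<and> i \<noteq> k"
    define \<rho>2 where "\<rho>2 = \<rho>(8 := y, 9 := k, 7 := y)"
    have r: "\<rho>2 2 = \<rho> 2" "\<rho>2 9 = k" "\<rho>2 5 = \<rho> 5" "\<rho>2 4 = \<rho> 4" "\<rho>2 6 = \<rho> 6" "\<rho>2 7 = y"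
      by (simp_all add: \<rho>2_def)
    have "bit (leaf \<gamma> (\<rho>2 2)) (\<rho>2 9)" using cursorD(8)[OF cu k] by (simp add: r)
    from elem_exp(1,2)[OF v this] cursor_emit[OF v cu k y]
    show "wp (Out elem_exp) ?Q (\<rho>(8 := y, 9 := k, 7 := y)) \<gamma> os"
      unfolding \<rho>2_def[symmetric] by (simp add: r cursor_state_def)
  qed (use that in simp_all)
  have next_leaf: "wp next_leaf ?R \<rho> \<gamma> os"
    if c: "cursor_state \<gamma> S \<rho> \<gamma> os" and "\<rho> 6 \<noteq> 0" "\<rho> 7 = 0" for \<rho>
  proof (rule wp_next_leaf[OF v])
    have cu: "cursor \<gamma> S os (\<rho> 5) (\<rho> 4) (\<rho> 6) (\<rho> 2) 0"
      using c that(3) by (simp add: cursor_state_def)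
    show "active \<gamma> (\<rho> 4)" using cursorD(4)[OF cu] that(2) by blast
    show "bit (summ \<gamma> (\<rho> 4)) l" if "bit (\<rho> 6) l" for l using cursorD(5)[OF cu that] .
    fix l and y :: nat
    assume l: "bit (\<rho> 6) l" "l < f" and y: "\<And>i. bit y i \<longleftrightarrow> bit (\<rho> 6) i \<and> i \<noteq> l"
    have "leaf \<gamma> (\<rho> 4 * f + l) \<noteq> 0"
      using D(5)[of "\<rho> 4 * f + l"] cursorD(5)[OF cu l(1)] div_mod_f[OF l(2)] by simp
    then show "?R (\<rho>(8 := y, 3 := l, 6 := y, 2 := \<rho> 4 * f + l, 7 := leaf \<gamma> (\<rho> 4 * f + l))) \<gamma> os"
      using cursor_leaf[OF v cu l y] by (intro out) (simp_all add: cursor_state_def)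
  qed (use that in simp)
  show ?thesis
  proof (cases "\<rho> 7 = 0")
    case False
    then show ?thesis using out[OF c] by (simp add: emit_com_def)
  next
    case x0: True
    show ?thesis
    proof (cases "\<rho> 6 = 0")
      case False
      then show ?thesis using next_leaf[OF c] x0 by (simp add: emit_com_def)
    next
      case True
      have cu: "cursor \<gamma> S os (\<rho> 5) (\<rho> 4) 0 (\<rho> 2) 0"
        using c x0 True by (simp add: cursor_state_def)
      have p: "\<rho> 5 < \<gamma> Cnt 0" using nz x0 True by simp
      have cN: "\<gamma> Cnt 0 \<le> N" using D(3) by (simp add: sparse_def)
      have a: "active \<gamma> (\<gamma> Lst (\<rho> 5))" using active_Lst[OF D(3) p] .
      have s: "\<gamma> Summ (\<gamma> Lst (\<rho> 5)) = summ \<gamma> (\<gamma> Lst (\<rho> 5))" using a by (simp add: summ_def)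
      let ?\<rho> = "\<rho>(4 := \<gamma> Lst (\<rho> 5), 5 := Suc (\<rho> 5), 6 := summ \<gamma> (\<gamma> Lst (\<rho> 5)))"
      have "cursor_state \<gamma> S ?\<rho> \<gamma> os"
        using cursor_block[OF v cu p] x0 by (simp add: cursor_state_def)
      from next_leaf[OF this] have "wp next_leaf ?R ?\<rho> \<gamma> os"
        using D(4)[OF a] x0 by simp
      moreover have "Suc (\<rho> 5) < 2 ^ (K * w)" using p cN N_less pow_f_less by linarith
      ultimately show ?thesis
        using x0 True p cN s sparseD(1)[OF D(3) p] by (simp add: emit_com_def next_block_def)
    qed
  qed
qed

text \<open>The output length is the termination measure: each iteration extends the output, and the
  invariant bounds it by \<open>B\<close>. The additional 1 pays for the final failing test.\<close>

lemma while_sound: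
  assumes step: "\<And>\<rho> \<gamma> os. I \<rho> \<gamma> os \<Longrightarrow> mok \<rho> \<gamma> b \<and> length os \<le> B \<and>
      (mval \<rho> \<gamma> b \<noteq> 0 \<longrightarrow> wp c (\<lambda>\<rho>' \<gamma>' os'. I \<rho>' \<gamma>' os' \<and> length os < length os') \<rho> \<gamma> os)"
    and "sim s \<rho> \<gamma> os" "I \<rho> \<gamma> os"
  shows "\<exists>t s' \<rho>' \<gamma>' os'. exec w K (While (compile_exp h b) (compile h c)) s t s' \<and>
    t \<le> (B - length os + 1) * (1 + cost (compile_exp h b) + max_time (compile h c)) \<and>
    sim s' \<rho>' \<gamma>' os' \<and> I \<rho>' \<gamma>' os' \<and> mval \<rho>' \<gamma>' b = 0"
  using assms(2,3)
proof (induction "B - length os" arbitrary: s \<rho> \<gamma> os rule: less_induct)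
  case less
  let ?C = "1 + cost (compile_exp h b) + max_time (compile h c)"
  note st = step[OF less.prems(2)]
  have e: "eval_expr w K s (compile_exp h b) = mval \<rho> \<gamma> b"
    using mval_eq[OF less.prems(1)] st by blast
  show ?case
  proof (cases "mval \<rho> \<gamma> b = 0")
    case True
    then have "exec w K (While (compile_exp h b) (compile h c)) s (1 + cost (compile_exp h b)) s"
      using e by (intro exec.WhileFalse) simp
    moreover have "1 + cost (compile_exp h b) \<le> (B - length os + 1) * ?C" by simp
    ultimately show ?thesis using less.prems True by blast
  next
    case False
    then obtain t s' \<rho>' \<gamma>' os' where 1: "exec w K (compile h c) s t s'" "t \<le> max_time (compile h c)"
      "sim s' \<rho>' \<gamma>' os'" "I \<rho>' \<gamma>' os'" "length os < length os'"
      using wp_sound[OF less.prems(1)] st by blast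
    have len: "length os' \<le> B" using step[OF 1(4)] by blast
    then have lt: "B - length os' < B - length os" using 1(5) by simp
    from less.hyps[OF lt 1(3,4)] obtain t' s'' \<rho>'' \<gamma>'' os'' where
      2: "exec w K (While (compile_exp h b) (compile h c)) s' t' s''" "t' \<le> (B - length os' + 1) * ?C"
      "sim s'' \<rho>'' \<gamma>'' os''" "I \<rho>'' \<gamma>'' os''" "mval \<rho>'' \<gamma>'' b = 0" by blast
    have "exec w K (While (compile_exp h b) (compile h c)) s (1 + cost (compile_exp h b) + t + t') s''"
      using e False 1(1) 2(1) by (intro exec.WhileTrue) simp_all
    moreover have "1 + cost (compile_exp h b) + t + t' \<le> (B - length os + 1) * ?C"
    proof -
      have "1 + cost (compile_exp h b) + t + t' \<le> ?C + (B - length os' + 1) * ?C"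
        using 1(2) 2(2) by simp
      also have "\<dots> = (B - length os' + 1 + 1) * ?C" by simp
      also have "\<dots> \<le> (B - length os + 1) * ?C" using lt by (intro mult_le_mono1) simp
      finally show ?thesis .
    qed
    ultimately show ?thesis using 2 by blast
  qed
qed

section \<open>Complete programs and space\<close>

text \<open>The surplus 8 is \<open>4 + 2 + 2\<close>: computing \<open>f\<close>, fetching the
  argument, returning the result.\<close>

lemma program_halts:
  assumes f: "f = nat \<lfloor>log 2 (real n)\<rfloor> + 1" and len: "length m = cells * f" and i: "i \<le> n"
    and T: "T + 8 \<le> T'"
    and run: "\<And>s. sim s ((\<lambda>_. 0)(0 := i)) (contents m) [] \<Longrightarrow>
      \<exists>t s' \<rho> \<gamma> os. exec w K c s t s' \<and> t \<le> T \<and> sim s' \<rho> \<gamma> os \<and> Q \<rho> \<gamma> os"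
  shows "halts_within w K (program c) (call_state w K n i m) T'
    (\<lambda>s. length (mem s) = cells * f \<and> (\<exists>\<rho>. regs s 0 = \<rho> 0 \<and> Q \<rho> (contents (mem s)) (out s)))"
proof -
  define s0 where "s0 = call_state w K n i m"
  have n: "n < 2 ^ (K * w)" using n_less less_W by blast
  have "w \<le> K * w" using K_w_pos(1) by (cases K) auto
  then have w: "w < 2 ^ (K * w)"
    using less_exp[of w] power_increasing[of w "K * w" "2::nat"] by linarith
  have "f - 1 < 2 ^ (K * w)" using f_less_W by linarith
  moreover have "regs s0 = (\<lambda>r. take_bit (K * w) (((\<lambda>_. 0)(0 := i, 1 := n, 2 := f - 1, 3 := w)) r))"
    by (simp add: s0_def call_state_def f)
  ultimately have r0: "regs s0 0 = i" "regs s0 1 = n" "regs s0 2 = f - 1" "regs s0 3 = w"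
    "\<And>r. 3 < r \<Longrightarrow> regs s0 r = 0"
    using n w i by simp_all
  have s0: "mem s0 = m" "out s0 = []" by (simp_all add: s0_def call_state_def)
  define s1 where "s1 = s0\<lparr>regs := (regs s0)(4 := f)\<rparr>"
  define s2 where "s2 = s1\<lparr>regs := (regs s1)(7 := i)\<rparr>"
  have "eval_expr w K s0 (Op Add (Reg 2) (Const 1)) = f"
    using f_pos f_less_W W_gt1 by (simp add: r0)
  then have e1: "exec w K (Assign 4 (Op Add (Reg 2) (Const 1))) s0 4 s1"
    using exec.Assign[of w K 4 "Op Add (Reg 2) (Const 1)" s0] by (simp add: s1_def eval_nat_numeral)
  have e2: "exec w K (Assign 7 (Reg 0)) s1 2 s2"
    using exec.Assign[of w K 7 "Reg 0" s1] by (simp add: s2_def s1_def r0 eval_nat_numeral)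
  have "sim s2 ((\<lambda>_. 0)(0 := i)) (contents m) []"
    by (simp add: sim_def s2_def s1_def r0 s0 len r0(2)[unfolded One_nat_def])
  from run[OF this] obtain t s3 \<rho> \<gamma> os where
    3: "exec w K c s2 t s3" "t \<le> T" "sim s3 \<rho> \<gamma> os" "Q \<rho> \<gamma> os" by blast
  define s4 where "s4 = s3\<lparr>regs := (regs s3)(0 := \<rho> 0)\<rparr>"
  have r7: "regs s3 7 = \<rho> 0"
    using 3(3) unfolding sim_def by (metis add_0)
  have e4: "exec w K (Assign 0 (Reg 7)) s3 2 s4"
    using exec.Assign[of w K 0 "Reg 7" s3] r7 by (simp add: s4_def eval_nat_numeral)
  have "exec w K (program c) s0 (4 + (2 + (t + 2))) s4"
    unfolding program_def by (rule exec.Seq[OF e1 exec.Seq[OF e2 exec.Seq[OF 3(1) e4]]])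
  moreover have "length (mem s4) = cells * f \<and> (\<exists>\<rho>. regs s4 0 = \<rho> 0 \<and> Q \<rho> (contents (mem s4)) (out s4))"
    using 3(3,4) by (auto simp: s4_def sim_def)
  moreover have "4 + (2 + (t + 2)) \<le> T'" using 3(2) T by simp
  ultimately show ?thesis unfolding halts_within_def s0_def by blast
qed

lemma wp_program_halts:
  assumes "f = nat \<lfloor>log 2 (real n)\<rfloor> + 1" "length m = cells * f" "i \<le> n"
    and T: "max_time (compile h c) + 8 \<le> T"
    and w: "wp c Q ((\<lambda>_. 0)(0 := i)) (contents m) []"
    and R: "\<And>s \<rho>. length (mem s) = cells * f \<Longrightarrow> regs s 0 = \<rho> 0 \<Longrightarrow>
      Q \<rho> (contents (mem s)) (out s) \<Longrightarrow> R s"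
  shows "halts_within w K (program (compile h c)) (call_state w K n i m) T R"
  using program_halts[OF assms(1-4) wp_sound[OF _ w]] R unfolding halts_within_def by blast

lemma enum_halts:
  assumes "f = nat \<lfloor>log 2 (real n)\<rfloor> + 1" "length m = cells * f" and v: "valid (contents m) S"
    and T: "max_time (compile h start_com) + cost (compile_exp h pending_exp) + max_time (compile h emit_com) + 9 \<le> T"
  shows "halts_within w K (enum_prog (programs h)) (call_state w K n 0 m) (T * (card S + 1))
    (\<lambda>s. (length (mem s) = cells * f \<and> valid (contents (mem s)) S) \<and> distinct (out s) \<and> set (out s) = S)"
proof -
  let ?\<gamma> = "contents m" and ?C = "1 + cost (compile_exp h pending_exp) + max_time (compile h emit_com)"
  let ?c = "Seq (compile h start_com) (While (compile_exp h pending_exp) (compile h emit_com))"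
  let ?Q = "\<lambda>\<rho> \<gamma>' os. cursor_state ?\<gamma> S \<rho> \<gamma>' os \<and> mval \<rho> \<gamma>' pending_exp = 0"
  have fin: "finite S" using validD(1)[OF v] finite_subset by blast
  have step: "mok \<rho> \<gamma> pending_exp \<and> length os \<le> card S \<and> (mval \<rho> \<gamma> pending_exp \<noteq> 0 \<longrightarrow>
      wp emit_com (\<lambda>\<rho>' \<gamma>' os'. cursor_state ?\<gamma> S \<rho>' \<gamma>' os' \<and> length os < length os') \<rho> \<gamma> os)"
    if c: "cursor_state ?\<gamma> S \<rho> \<gamma> os" for \<rho> \<gamma> os
  proof -
    have g: "\<gamma> = ?\<gamma>" "distinct os" "set os \<subseteq> S"
      using c cursorD(1,2) unfolding cursor_state_def by blast+
    \<comment> \<open>The outputs are distinct members of \<open>S\<close>, so the loop is charged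
      per element of \<open>S\<close>.\<close>
    have "length os \<le> card S" using g(2,3) fin card_mono distinct_card by metis
    then show ?thesis
      using pending_exp[OF v c] wp_emit[OF v c[unfolded g(1)]] g(1) by blast
  qed
  have run: "\<exists>t s' \<rho> \<gamma> os. exec w K ?c s t s' \<and>
      t \<le> max_time (compile h start_com) + (card S + 1) * ?C \<and> sim s' \<rho> \<gamma> os \<and> ?Q \<rho> \<gamma> os"
    if sim: "sim s ((\<lambda>_. 0)(0 := 0)) ?\<gamma> []" for s
  proof -
    have "wp start_com (\<lambda>\<rho> \<gamma> os. cursor_state ?\<gamma> S \<rho> \<gamma> os \<and> os = []) ((\<lambda>_. 0)(0 := 0)) ?\<gamma> []"
      using cursor_start[OF v] by (simp add: start_com_def cursor_state_def)
    from wp_sound[OF sim this] obtain t s' \<rho> \<gamma> where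
      1: "exec w K (compile h start_com) s t s'" "t \<le> max_time (compile h start_com)"
      "sim s' \<rho> \<gamma> []" "cursor_state ?\<gamma> S \<rho> \<gamma> []" by blast
    from while_sound[of "cursor_state ?\<gamma> S", OF step 1(3,4)] obtain t' s'' \<rho>' \<gamma>' os where
      2: "exec w K (While (compile_exp h pending_exp) (compile h emit_com)) s' t' s''"
      "t' \<le> (card S + 1) * ?C" "sim s'' \<rho>' \<gamma>' os" "?Q \<rho>' \<gamma>' os" by auto
    have "t + t' \<le> max_time (compile h start_com) + (card S + 1) * ?C" using 1(2) 2(2) by simp
    then show ?thesis using exec.Seq[OF 1(1) 2(1)] 2(3,4) by blast
  qed
  have "max_time (compile h start_com) + (card S + 1) * ?C + 8 \<le> T * (card S + 1)"
  proof -
    have "max_time (compile h start_com) + (card S + 1) * ?C + 8 \<le>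
        (card S + 1) * (max_time (compile h start_com) + ?C + 8)" by (simp add: algebra_simps)
    also have "\<dots> \<le> (card S + 1) * T" using T by (intro mult_le_mono2) simp
    finally show ?thesis by (simp add: mult.commute)
  qed
  from program_halts[OF assms(1,2) _ this run, of 0]
  obtain t s' \<rho> where s': "exec w K (program ?c) (call_state w K n 0 m) t s'" "t \<le> T * (card S + 1)"
    "length (mem s') = cells * f" "?Q \<rho> (contents (mem s')) (out s')"
    unfolding halts_within_def by auto
  then have g: "contents (mem s') = ?\<gamma>" and c: "cursor_state ?\<gamma> S \<rho> ?\<gamma> (out s')"
    and z: "mval \<rho> ?\<gamma> pending_exp = 0"
    by (auto simp: cursor_state_def)
  have z': "\<not> \<rho> 5 < ?\<gamma> Cnt 0" "\<rho> 6 = 0" "\<rho> 7 = 0" using pending_exp(2)[OF v c] z by auto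
  have "cursor ?\<gamma> S (out s') (\<rho> 5) (\<rho> 4) 0 (\<rho> 2) 0" using c z' by (simp add: cursor_state_def)
  from cursor_done[OF v this z'(1)] have "(length (mem s') = cells * f \<and> valid (contents (mem s')) S) \<and>
      distinct (out s') \<and> set (out s') = S"
    using s'(3) v g by simp
  then show ?thesis
    using s'(1,2) unfolding halts_within_def programs_def set_programs.simps by blast
qed

lemma maintains:
  assumes f: "f = nat \<lfloor>log 2 (real n)\<rfloor> + 1"
  shows "maintains_set w K (programs h) n (cells * f) (time_bound h)"
  unfolding maintains_set_def
proof (intro exI[of _ "\<lambda>m S. length m = cells * f \<and> valid (contents m) S"] conjI allI impI ballI)
  fix m :: "bool list" assume m: "length m = cells * f"
  show "halts_within w K (init_prog (programs h)) (call_state w K n 0 m) (time_bound h)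
      (\<lambda>s. length (mem s) = cells * f \<and> valid (contents (mem s)) {})"
    unfolding programs_def set_programs.simps
    by (rule wp_program_halts[OF f m _ _ wp_init]) (simp_all add: time_bound_def)
next
  fix m :: "bool list" and S
  assume mS: "length m = cells * f \<and> S \<subseteq> {1..n} \<and> length m = cells * f \<and> valid (contents m) S"
  then have m: "length m = cells * f" and v: "valid (contents m) S" by auto
  show "halts_within w K (findany_prog (programs h)) (call_state w K n 0 m) (time_bound h)
      (\<lambda>s. (length (mem s) = cells * f \<and> valid (contents (mem s)) S) \<and>
        (if S = {} then regs s 0 = 0 else regs s 0 \<in> S))"
    unfolding programs_def set_programs.simps
    by (rule wp_program_halts[OF f m _ _ wp_findany[OF v]]) (simp_all add: time_bound_def)
  show "halts_within w K (enum_prog (programs h)) (call_state w K n 0 m) (time_bound h * (card S + 1))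
      (\<lambda>s. (length (mem s) = cells * f \<and> valid (contents (mem s)) S) \<and>
        distinct (out s) \<and> set (out s) = S)"
    by (rule enum_halts[OF f m v]) (simp add: time_bound_def)
  fix i assume "i \<in> {1..n}"
  then obtain j where i: "i = Suc j" "j < n" "i \<le> n" by (cases i) auto
  have a: "((\<lambda>_. 0)(0 := i)) 0 = Suc j" using i by simp
  show "halts_within w K (insert_prog (programs h)) (call_state w K n i m) (time_bound h)
      (\<lambda>s. length (mem s) = cells * f \<and> valid (contents (mem s)) (S \<union> {i}))"
    unfolding programs_def set_programs.simps
    by (rule wp_program_halts[OF f m i(3) _ wp_insert[where \<rho> = "(\<lambda>_. 0)(0 := i)" and j = j, OF v a i(2)]]) (simp_all add: time_bound_def i(1))
  show "halts_within w K (delete_prog (programs h)) (call_state w K n i m) (time_bound h)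
      (\<lambda>s. length (mem s) = cells * f \<and> valid (contents (mem s)) (S - {i}))"
    unfolding programs_def set_programs.simps
    by (rule wp_program_halts[OF f m i(3) _ wp_delete[where \<rho> = "(\<lambda>_. 0)(0 := i)" and j = j, OF v a i(2)]]) (simp_all add: time_bound_def i(1))
  show "halts_within w K (search_prog (programs h)) (call_state w K n i m) (time_bound h)
      (\<lambda>s. (length (mem s) = cells * f \<and> valid (contents (mem s)) S) \<and> regs s 0 = of_bool (i \<in> S))"
    unfolding programs_def set_programs.simps
    by (rule wp_program_halts[OF f m i(3) _ wp_search[where \<rho> = "(\<lambda>_. 0)(0 := i)" and j = j, OF v a i(2)]]) (simp_all add: time_bound_def i(1))
qed

text \<open>Makes the truncated subtraction \<open>cells * f - n\<close> exact, so that
  \<open>n\<close> plus the excess is the memory size.\<close>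

lemma n_le_cells: "n \<le> cells * f"
proof -
  have "(n - 1) div f div f < N" using cover(2)[of "n - 1"] n_pos by simp
  then have "n - 1 < N * f * f" using f_pos by (simp add: div_less_iff_less_mult)
  also have "\<dots> \<le> cells * f" by (intro mult_le_mono1) (simp add: cells_def)
  finally show ?thesis by simp
qed

text \<open>The term \<open>f ^ 2\<close> comes from rounding up to whole blocks,
  \<open>3 * (n / f)\<close> from the three arrays with one cell per block, \<open>4 * f\<close>
  from rounding in these and from the counter, and the last term is the table.\<close>

lemma excess_le:
  "real (cells * f - n) \<le> real f ^ 2 + 3 * (real n / real f) + 4 * real f + real M * real f"
proof -
  have f: "real f > 0" using f_pos by simp
  have "real (N - 1) \<le> real (n - 1) / real (f * f)"
    unfolding N_def using of_nat_div_le_of_nat[of "n - 1" "f * f", where ?'a = real] by simp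
  also have "\<dots> \<le> real n / real (f * f)" by (intro divide_right_mono) auto
  finally have N: "real N \<le> real n / (real f * real f) + 1" using N_pos by simp
  have "real N * (real f * real f) \<le> (real n / (real f * real f) + 1) * (real f * real f)"
    using N by (intro mult_right_mono) auto
  also have "\<dots> = real n + real f * real f" using f by (simp add: field_simps)
  finally have 1: "real N * (real f * real f) \<le> real n + real f * real f" .
  have "real N * real f \<le> (real n / (real f * real f) + 1) * real f"
    using N by (intro mult_right_mono) auto
  also have "\<dots> = real n / real f + real f" using f by (simp add: field_simps)
  finally have 2: "real N * real f \<le> real n / real f + real f" .
  have "real (cells * f - n) = real (cells * f) - real n"
    using n_le_cells by (simp add: of_nat_diff)
  also have "\<dots> = real N * (real f * real f) + 3 * (real N * real f) + real f + real M * real f - real n"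
    by (simp add: cells_def algebra_simps)
  also have "\<dots> \<le> real f ^ 2 + 3 * (real n / real f) + 4 * real f + real M * real f"
    using 1 2 by (simp add: power2_eq_square)
  finally show ?thesis .
qed

end

section \<open>Asymptotics of word length and space\<close>

lemma floor_log_bounds:
  fixes n f :: nat
  assumes "1 \<le> n" "f = nat \<lfloor>log 2 (real n)\<rfloor> + 1"
  shows "n < 2 ^ f" "f \<le> n" "log 2 (real n) \<le> real f" "real f \<le> log 2 (real n) + 1"
proof -
  have l0: "0 \<le> log 2 (real n)" using assms(1) by simp
  have f: "real f = of_int \<lfloor>log 2 (real n)\<rfloor> + 1"
    unfolding assms(2) using l0 by simp
  show 1: "log 2 (real n) \<le> real f" "real f \<le> log 2 (real n) + 1" unfolding f by linarith+
  have "log 2 (real n) < real f" unfolding f by linarith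
  then have "real n < 2 powr real f" using assms(1) by (simp add: log_less_iff)
  then show "n < 2 ^ f" by (simp add: powr_realpow)
  have "2 powr (real f - 1) \<le> real n"
    using 1(2) assms(1) by (simp add: le_log_iff[symmetric])
  then have "2 ^ (f - 1) \<le> real n" using assms(2) by (simp add: powr_realpow[symmetric])
  then have "2 ^ (f - 1) \<le> n" by simp
  then show "f \<le> n" using less_exp[of "f - 1"] assms(2) by linarith
qed

text \<open>The asymptotic bound yields a constant only from some \<open>n0\<close> on; for smaller
  \<open>n\<close> the crude \<open>f \<le> n\<close> and \<open>1 \<le> w n\<close>
  suffice.\<close>

lemma words_per_cell:
  fixes w :: "nat \<Rightarrow> nat"
  assumes "\<forall>n\<ge>1. w n \<ge> 1" and "(\<lambda>n. real (w n)) \<in> \<Omega>(\<lambda>n. log 2 (real n))"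
  obtains h where "\<And>n. 1 \<le> n \<Longrightarrow> nat \<lfloor>log 2 (real n)\<rfloor> + 1 \<le> h * w n"
proof -
  obtain c where c: "c > 0" "eventually (\<lambda>n. norm (real (w n)) \<ge> c * norm (log 2 (real n))) at_top"
    using assms(2) by (elim landau_omega.bigE)
  then obtain n0 where n0: "\<And>n. n \<ge> n0 \<Longrightarrow> real (w n) \<ge> c * \<bar>log 2 (real n)\<bar>"
    by (auto simp: eventually_at_top_linorder)
  \<comment> \<open>The factor 2 absorbs the rounding,
    \<open>f \<le> log 2 n + 1 \<le> 2 * log 2 n\<close> for \<open>n \<ge> 2\<close>;
    \<open>n0 + 1\<close> serves the small \<open>n\<close>.\<close>
  define h where "h = nat \<lceil>2 / c\<rceil> + n0 + 1"
  have "nat \<lfloor>log 2 (real n)\<rfloor> + 1 \<le> h * w n" if n: "1 \<le> n" for n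
  proof -
    define f where "f = nat \<lfloor>log 2 (real n)\<rfloor> + 1"
    note B = floor_log_bounds[OF n f_def]
    have w: "1 \<le> w n" using assms(1) n by blast
    show ?thesis
    proof (cases "n \<le> n0 + 1")
      case True
      have "f \<le> h * 1" using B(2) True by (simp add: h_def)
      also have "\<dots> \<le> h * w n" using w by (intro mult_le_mono2)
      finally show ?thesis by (simp add: f_def)
    next
      case False
      have "log 2 2 \<le> log 2 (real n)" using False by (subst log_le_cancel_iff) auto
      then have l: "1 \<le> log 2 (real n)" by simp
      have "c * log 2 (real n) \<le> real (w n)" using n0[of n] False l by simp
      then have "log 2 (real n) \<le> real (w n) / c" using c(1) by (simp add: field_simps)
      then have "real f \<le> 2 * (real (w n) / c)" using B(4) l by linarith
      also have "\<dots> = 2 / c * real (w n)" by simp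
      also have "\<dots> \<le> real h * real (w n)"
        unfolding h_def by (intro mult_right_mono) linarith+
      finally have "real f \<le> real (h * w n)" by simp
      then show ?thesis unfolding f_def by linarith
    qed
  qed
  then show ?thesis by (rule that)
qed

text \<open>The floor is removed by passing to a smooth majorant \<open>g\<close>: \<open>f\<close>
  lies between \<open>log 2 n\<close> and \<open>log 2 n + 1\<close>, and
  \<open>2 ^ (f div 2)\<close> is at most \<open>sqrt (2 ^ f) \<le> sqrt (2 * n)\<close>. Starting
  at \<open>n = 2\<close> keeps the logarithm in the denominator at least 1.\<close>

lemma excess_smallo:
  fixes e :: "nat \<Rightarrow> nat"
  assumes "\<And>n. 1 \<le> n \<Longrightarrow> f n = nat \<lfloor>log 2 (real n)\<rfloor> + 1"
    and e: "\<And>n. 1 \<le> n \<Longrightarrow> real (e n) \<le> real (f n) ^ 2 + 3 * (real n / real (f n)) + 4 * real (f n) +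
      (2 ^ (f n div 2 + 1) + 1) * real (f n)"
  shows "(\<lambda>n. real (e n)) \<in> o(\<lambda>n. real n)"
proof -
  define g where "g = (\<lambda>n. (log 2 (real n) + 1) ^ 2 + 3 * (real n / log 2 (real n)) + 4 * (log 2 (real n) + 1) +
      (2 * sqrt (2 * real n) + 1) * (log 2 (real n) + 1))"
  have le: "real (e n) \<le> g n" if n: "2 \<le> n" for n
  proof -
    have n1: "1 \<le> n" using n by simp
    define F where "F = f n"
    note B = floor_log_bounds[OF n1 assms(1)[OF n1], folded F_def]
    define l where "l = log 2 (real n)"
    have "log 2 2 \<le> l" unfolding l_def using n by (subst log_le_cancel_iff) auto
    then have l: "1 \<le> l" by simp
    have F: "l \<le> real F" "real F \<le> l + 1" using B by (simp_all add: l_def)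
    have "(2 ^ (F div 2)) ^ 2 \<le> (2::real) ^ F"
      unfolding power_mult[symmetric] by (intro power_increasing) auto
    also have "(2::real) ^ F \<le> 2 powr (l + 1)"
      using F(2) by (simp add: powr_realpow[symmetric])
    also have "\<dots> = 2 * real n" using n by (simp add: powr_add l_def)
    finally have "2 ^ (F div 2) \<le> sqrt (2 * real n)" by (intro real_le_rsqrt)
    then have "(2::real) ^ (F div 2 + 1) + 1 \<le> 2 * sqrt (2 * real n) + 1" by simp
    then have 1: "((2::real) ^ (F div 2 + 1) + 1) * real F \<le> (2 * sqrt (2 * real n) + 1) * (l + 1)"
      using F(2) l by (intro mult_mono) auto
    have 2: "real F ^ 2 \<le> (l + 1) ^ 2" using F(2) by (intro power_mono) auto
    have 3: "real n / real F \<le> real n / l" using F(1) l by (intro divide_left_mono) auto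
    note e[OF n1, folded F_def]
    also have "real F ^ 2 + 3 * (real n / real F) + 4 * real F + (2 ^ (F div 2 + 1) + 1) * real F \<le> g n"
      unfolding g_def l_def[symmetric] using 1 2 3 F(2) by (intro add_mono mult_left_mono) auto
    finally show ?thesis .
  qed
  have "(\<lambda>n. real (e n)) \<in> O(g)"
    by (rule bigoI[where c = 1], rule eventually_at_top_linorderI[of 2]) (use le in force)
  moreover have "g \<in> o(\<lambda>n. real n)"
    unfolding g_def by real_asymp
  ultimately show ?thesis by (rule landau_o.big_small_trans)
qed

theorem theorem3:
  fixes w :: "nat \<Rightarrow> nat"
  assumes "\<forall>n\<ge>1. w n \<ge> 1"
    and "(\<lambda>n. real (w n)) \<in> \<Omega>(\<lambda>n. log 2 (real n))"
  shows "\<exists>(K::nat) (D::set_programs) (e :: nat \<Rightarrow> nat) (T::nat).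
           (\<lambda>n. real (e n)) \<in> o(\<lambda>n. real n) \<and>
           (\<forall>n\<ge>1. maintains_set (w n) K D n (n + e n) T)"
proof -
  obtain h where h: "\<And>n. 1 \<le> n \<Longrightarrow> nat \<lfloor>log 2 (real n)\<rfloor> + 1 \<le> h * w n"
    using words_per_cell[OF assms] by blast
  define f where "f = (\<lambda>n. nat \<lfloor>log 2 (real n)\<rfloor> + 1)"
  \<comment> \<open>The number of cells depends on \<open>n\<close> and \<open>f\<close> only, so
    the excess is chosen without reference to \<open>w\<close>.\<close>
  define e where "e = (\<lambda>n. layout.cells n (f n) * f n - n)"
  have L: "layout n (w n) (f n) h (4 * h + 8)" if "1 \<le> n" for n
    using that assms(1) h floor_log_bounds(1) by unfold_locales (auto simp: f_def)
  have "(\<lambda>n. real (e n)) \<in> o(\<lambda>n. real n)"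
  proof (rule excess_smallo[where f = f])
    fix n :: nat assume "1 \<le> n"
    from layout.excess_le[OF L[OF this]]
    show "real (e n) \<le> real (f n) ^ 2 + 3 * (real n / real (f n)) + 4 * real (f n) +
        (2 ^ (f n div 2 + 1) + 1) * real (f n)"
      unfolding layout.M_def[OF L[OF \<open>1 \<le> n\<close>]] e_def by (simp add: add.commute)
  qed (simp add: f_def)
  \<comment> \<open>Register size, programs and time bound depend on \<open>h\<close> alone, as the
    order of the quantifiers demands.\<close>
  moreover have "maintains_set (w n) (4 * h + 8) (programs h) n (n + e n) (time_bound h)" if "1 \<le> n" for n
    using layout.maintains[OF L[OF that]] layout.n_le_cells[OF L[OF that]] by (simp add: e_def f_def)
  ultimately show ?thesis by blast
qed

end
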